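(* Let $S\subset\mathbb R^3$ be a smooth oriented surface with local coordinates $x=(x_1,x_2)$, right-handed with respect to the orientation, in which the induced metric is $ds^2=a_{11}(x)\,dx_1^2+a_{22}(x)\,dx_2^2$. Let $K=K(x)$ be the Gaussian curvature of $S$. Consider a disk of mass $m$ constrained to be tangent to $S$ at the disk's center, with the contact point free to slide along $S$ and the disk free to spin about its axle, with kinetic energy $$E=\tfrac12 m v^2+\tfrac12 I_a\omega_a^2+\tfrac12 I_d\omega_d^2 ,$$ and define $$T=T(x,\dot x)=\tfrac12 m v^2+\tfrac12 I_d\omega_d^2 .$$ Then, along every motion of the disk, the angular momentum $L=I_a\omega_a$ about the disk's axle is conserved, and the motion $x(t)$ of the disk's center is governed by $$\frac{d}{dt}T_{\dot x}-T_x=\sqrt{a_{11}a_{22}}\;L\,(J\dot x)\,K,\qquad J=\begin{pmatrix}0&-1\\ 1&0\end{pmatrix}.$$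
   Context: Let $\mathbf n$ be the unit normal field of $S$ given by the orientation; right-handedness of $(x_1,x_2)$ means that the coordinate tangent vectors $\partial_{x_1},\partial_{x_2}$ together with $\mathbf n$ form a positively oriented basis of $\mathbb R^3$. Configuration space: a configuration of the disk consists of the position of its center, a point of $S$ with coordinates $x=(x_1,x_2)$, together with a unit vector $u$ tangent to $S$ at that point, pointing from the center of the disk along a marked material radius (so the configuration space is the unit tangent bundle of $S$). Locally it is parametrized by $(x_1,x_2,\theta)$, where $\theta$ is the angle, measured with respect to the orientation, from the direction of increasing $x_1$ (the positive direction of the lines $\{x_2=\text{const.}\}$) to $u$. Along a smooth curve in configuration space, let $\boldsymbol\omega$ be the angular velocity vector of the disk, i.e. the angular velocity of the moving orthonormal frame $(u,\mathbf n\times u,\mathbf n)$ in $\mathbb R^3$. Then: - $\omega_a=\langle\boldsymbol\omega,\mathbf n\rangle$ is the axial component of $\boldsymbol\omega$; equivalently $\omega_a=\langle D_tu,\mathbf n\times u\rangle$, where $D_t$ is the covariant derivative along the curve on $S$ traced by the center (so $\omega_a=0$ means that $u$ is parallel transported); - $\omega_d$ is the scalar value of the projection of $\boldsymbol\omega$ onto the plane of the disk (the component along a diameter), so that $\omega_d^2=\left|\frac{d}{dt}\mathbf n(x(t))\right|^2$, which depends only on $(x,\dot x)$; - $v$ is the speed of the center, $v^2=a_{11}\dot x_1^2+a_{22}\dot x_2^2$. $I_a>0$ and $I_d>0$ are the (constant) moments of inertia of the disk about its axis and about a diameter, respectively (for a disk, $I_a=2I_d$), and $m>0$. There are no external forces: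 a motion of the disk is a solution of the Euler–Lagrange equations, in the coordinates $(x_1,x_2,\theta)$, of the Lagrangian $E$. The subscripts in $T_{\dot x}$ and $T_x$ denote the gradients (vectors of partial derivatives) with respect to $\dot x=(\dot x_1,\dot x_2)$ and $x=(x_1,x_2)$. *)

theory Defs
  imports "HOL-Analysis.Analysis"
begin

unbundle cross3_syntax

section \<open>Smooth maps and surfaces\<close>

primrec times_differentiable_on ::
    "nat \<Rightarrow> 'a::real_normed_vector set \<Rightarrow> ('a \<Rightarrow> 'b::real_normed_vector) \<Rightarrow> bool" where
  "times_differentiable_on 0 U f \<longleftrightarrow> continuous_on U f"
| "times_differentiable_on (Suc k) U f \<longleftrightarrow>
     (\<forall>x\<in>U. f differentiable (at x)) \<and>
     (\<forall>v. times_differentiable_on k U (\<lambda>x. frechet_derivative f (at x) v))"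

definition smooth_on :: "'a::real_normed_vector set \<Rightarrow> ('a \<Rightarrow> 'b::real_normed_vector) \<Rightarrow> bool" where
  "smooth_on U f \<longleftrightarrow> (\<forall>k. times_differentiable_on k U f)"

text \<open>The map \<open>r\<close> is the inverse of a coordinate chart: it sends the coordinates \<open>(x\<^sub>1, x\<^sub>2)\<close>
  to the corresponding point of the surface.\<close>

definition local_coordinates :: "(real^3) set \<Rightarrow> (real^2) set \<Rightarrow> (real^2 \<Rightarrow> real^3) \<Rightarrow> bool" where
  "local_coordinates S U r \<longleftrightarrow>
     open U \<and> smooth_on U r \<and> (\<forall>x\<in>U. inj (frechet_derivative r (at x))) \<and>
     openin (top_of_set S) (r ` U) \<and> (\<exists>g. homeomorphism U (r ` U) r g)"

definition smooth_surface :: "(real^3) set \<Rightarrow> bool" where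
  "smooth_surface S \<longleftrightarrow> (\<forall>p\<in>S. \<exists>U r. local_coordinates S U r \<and> p \<in> r ` U)"

definition tangent_plane :: "(real^3) set \<Rightarrow> real^3 \<Rightarrow> (real^3) set" where
  "tangent_plane S p =
     {frechet_derivative r (at x) v | U r x v. local_coordinates S U r \<and> x \<in> U \<and> r x = p}"

text \<open>An orientation is a choice of a continuous unit normal field.\<close>

definition surface_orientation :: "(real^3) set \<Rightarrow> (real^3 \<Rightarrow> real^3) \<Rightarrow> bool" where
  "surface_orientation S N \<longleftrightarrow>
     continuous_on S N \<and> (\<forall>p\<in>S. norm (N p) = 1 \<and> (\<forall>w \<in> tangent_plane S p. N p \<bullet> w = 0))"

definition coord_vector :: "(real^2 \<Rightarrow> real^3) \<Rightarrow> 2 \<Rightarrow> real^2 \<Rightarrow> real^3" where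
  "coord_vector r i x = frechet_derivative r (at x) (axis i 1)"

definition right_handed_coordinates ::
    "(real^3 \<Rightarrow> real^3) \<Rightarrow> (real^2) set \<Rightarrow> (real^2 \<Rightarrow> real^3) \<Rightarrow> bool" where
  "right_handed_coordinates N U r \<longleftrightarrow>
     (\<forall>x\<in>U. det (vector [coord_vector r 1 x, coord_vector r 2 x, N (r x)] :: real^3^3) > 0)"

definition first_form :: "(real^2 \<Rightarrow> real^3) \<Rightarrow> real^2 \<Rightarrow> real^2^2" where
  "first_form r x = (\<chi> i j. coord_vector r i x \<bullet> coord_vector r j x)"

definition second_form :: "(real^3 \<Rightarrow> real^3) \<Rightarrow> (real^2 \<Rightarrow> real^3) \<Rightarrow> real^2 \<Rightarrow> real^2^2" where
  "second_form N r x =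
     (\<chi> i j. frechet_derivative (coord_vector r j) (at x) (axis i 1) \<bullet> N (r x))"

definition gauss_curvature :: "(real^3 \<Rightarrow> real^3) \<Rightarrow> (real^2 \<Rightarrow> real^3) \<Rightarrow> real^2 \<Rightarrow> real" where
  "gauss_curvature N r x = det (second_form N r x) / det (first_form r x)"

section \<open>The disk\<close>

text \<open>A configuration is \<open>q = (x, \<theta>)\<close>. The material radius \<open>u\<close> is obtained by turning the unit
  vector in the direction of increasing \<open>x\<^sub>1\<close> by the angle \<open>\<theta>\<close> in the tangent plane, in the
  positive sense determined by the normal.\<close>

definition material_radius ::
    "(real^3 \<Rightarrow> real^3) \<Rightarrow> (real^2 \<Rightarrow> real^3) \<Rightarrow> (real^2) \<times> real \<Rightarrow> real^3" where
  "material_radius N r q =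
     (let e = sgn (coord_vector r 1 (fst q))
      in cos (snd q) *\<^sub>R e + sin (snd q) *\<^sub>R (N (r (fst q)) \<times> e))"

text \<open>The angular velocity at the configuration \<open>q\<close> with generalized velocity \<open>qd\<close> is the vector
  \<open>w\<close> such that each vector \<open>f\<close> of the frame \<open>(u, n \<times> u, n)\<close> has velocity \<open>w \<times> f\<close>. By the chain
  rule, the velocity of \<open>f\<close> along a curve in configuration space is the derivative of the field
  \<open>f\<close> in the direction \<open>qd\<close>; see \<open>angular_velocity_along_curve\<close>.\<close>

definition angular_velocity ::
    "(real^3 \<Rightarrow> real^3) \<Rightarrow> (real^2 \<Rightarrow> real^3) \<Rightarrow> (real^2) \<times> real \<Rightarrow> (real^2) \<times> real \<Rightarrow> real^3" where
  "angular_velocity N r q qd =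
     (let u = material_radius N r; n = (\<lambda>q. N (r (fst q))); b = (\<lambda>q. n q \<times> u q)
      in THE w. frechet_derivative u (at q) qd = w \<times> u q \<and>
                frechet_derivative b (at q) qd = w \<times> b q \<and>
                frechet_derivative n (at q) qd = w \<times> n q)"

definition axial_velocity ::
    "(real^3 \<Rightarrow> real^3) \<Rightarrow> (real^2 \<Rightarrow> real^3) \<Rightarrow> (real^2) \<times> real \<Rightarrow> (real^2) \<times> real \<Rightarrow> real" where
  "axial_velocity N r q qd = angular_velocity N r q qd \<bullet> N (r (fst q))"

definition diametral_velocity ::
    "(real^3 \<Rightarrow> real^3) \<Rightarrow> (real^2 \<Rightarrow> real^3) \<Rightarrow> (real^2) \<times> real \<Rightarrow> (real^2) \<times> real \<Rightarrow> real" where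
  "diametral_velocity N r q qd =
     norm (angular_velocity N r q qd - axial_velocity N r q qd *\<^sub>R N (r (fst q)))"

definition center_speed :: "(real^2 \<Rightarrow> real^3) \<Rightarrow> real^2 \<Rightarrow> real^2 \<Rightarrow> real" where
  "center_speed r x xd = norm (frechet_derivative r (at x) xd)"

definition kinetic_energy :: "real \<Rightarrow> real \<Rightarrow> real \<Rightarrow> (real^3 \<Rightarrow> real^3) \<Rightarrow> (real^2 \<Rightarrow> real^3) \<Rightarrow>
    (real^2) \<times> real \<Rightarrow> (real^2) \<times> real \<Rightarrow> real" where
  "kinetic_energy m I\<^sub>a I\<^sub>d N r q qd =
     1/2 * m * (center_speed r (fst q) (fst qd))\<^sup>2
     + 1/2 * I\<^sub>a * (axial_velocity N r q qd)\<^sup>2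
     + 1/2 * I\<^sub>d * (diametral_velocity N r q qd)\<^sup>2"

text \<open>The diametral velocity depends neither on \<open>\<theta>\<close> nor on its rate of change
  (\<open>diametral_velocity_sq\<close>), so both may be set to \<open>0\<close> here.\<close>

definition reduced_energy :: "real \<Rightarrow> real \<Rightarrow> (real^3 \<Rightarrow> real^3) \<Rightarrow> (real^2 \<Rightarrow> real^3) \<Rightarrow>
    real^2 \<Rightarrow> real^2 \<Rightarrow> real" where
  "reduced_energy m I\<^sub>d N r x xd =
     1/2 * m * (center_speed r x xd)\<^sup>2
     + 1/2 * I\<^sub>d * (diametral_velocity N r (x, 0) (xd, 0))\<^sup>2"

section \<open>Euler--Lagrange equations\<close>

definition gradient :: "('a::euclidean_space \<Rightarrow> real) \<Rightarrow> 'a \<Rightarrow> 'a" where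
  "gradient f x = (\<Sum>b\<in>Basis. frechet_derivative f (at x) b *\<^sub>R b)"

definition pos_gradient :: "('a::euclidean_space \<Rightarrow> 'a \<Rightarrow> real) \<Rightarrow> 'a \<Rightarrow> 'a \<Rightarrow> 'a" where
  "pos_gradient \<L> q qd = gradient (\<lambda>y. \<L> y qd) q"

definition vel_gradient :: "('a::euclidean_space \<Rightarrow> 'a \<Rightarrow> real) \<Rightarrow> 'a \<Rightarrow> 'a \<Rightarrow> 'a" where
  "vel_gradient \<L> q qd = gradient (\<lambda>w. \<L> q w) qd"

abbreviation velocity :: "(real \<Rightarrow> 'a::real_normed_vector) \<Rightarrow> real \<Rightarrow> 'a" where
  "velocity c \<equiv> (\<lambda>t. vector_derivative c (at t))"

definition euler_lagrange_solution ::
    "('a::euclidean_space \<Rightarrow> 'a \<Rightarrow> real) \<Rightarrow> 'a set \<Rightarrow> real set \<Rightarrow> (real \<Rightarrow> 'a) \<Rightarrow> bool" where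
  "euler_lagrange_solution \<L> Q J q \<longleftrightarrow>
     (\<forall>t\<in>J. q t \<in> Q \<and> q differentiable (at t) \<and> velocity q differentiable (at t) \<and>
        ((\<lambda>s. vel_gradient \<L> (q s) (velocity q s))
           has_vector_derivative pos_gradient \<L> (q t) (velocity q t)) (at t))"

section \<open>The angular velocity is well defined\<close>

lemma bounded_bilinear_cross3: "bounded_bilinear (\<times>)"
  using bilinear_cross bilinear_conv_bounded_bilinear by blast

lemma differentiable_cross3:
  "f differentiable (at x) \<Longrightarrow> g differentiable (at x) \<Longrightarrow> (\<lambda>y. f y \<times> g y) differentiable (at x)"
  using bounded_bilinear.FDERIV[OF bounded_bilinear_cross3] unfolding differentiable_def by blast

lemma differentiable_sgn:
  fixes f :: "'a::real_normed_vector \<Rightarrow> 'b::real_inner"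
  assumes "f differentiable (at x)" "f x \<noteq> 0"
  shows "(\<lambda>y. sgn (f y)) differentiable (at x)"
proof -
  have "(\<lambda>y. norm (f y)) differentiable (at x)"
    using differentiable_chain_at[OF assms(1) differentiable_norm_at[OF assms(2)]]
    by (simp add: o_def)
  then have "(\<lambda>y. inverse (norm (f y)) *\<^sub>R f y) differentiable (at x)"
    using assms by (intro differentiable_scaleR differentiable_inverse) auto
  then show ?thesis by (simp add: sgn_div_norm)
qed

lemma cross_orthonormal:
  fixes n u :: "real^3"
  assumes "n \<bullet> n = 1" "n \<bullet> u = 0"
  shows "(n \<times> u) \<times> n = u" "n \<times> (n \<times> u) = - u" "(norm (n \<times> u))\<^sup>2 = (norm u)\<^sup>2"
  using assms Lagrange[of n n u] cross_skew[of "n \<times> u" n] norm_cross[of n u]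
  by (auto simp: power2_norm_eq_inner)

lemma orthonormal_expansion:
  fixes n u v :: "real^3"
  assumes "n \<bullet> n = 1" "u \<bullet> u = 1" "n \<bullet> u = 0"
  shows "v = (v \<bullet> u) *\<^sub>R u + (v \<bullet> (n \<times> u)) *\<^sub>R (n \<times> u) + (v \<bullet> n) *\<^sub>R n"
proof -
  let ?z = "(v \<bullet> u) *\<^sub>R u + (v \<bullet> (n \<times> u)) *\<^sub>R (n \<times> u) + (v \<bullet> n) *\<^sub>R n"
  have nz: "n \<noteq> 0" using assms(1) by auto
  have un: "u \<bullet> n = 0" using assms(3) by (simp add: inner_commute)
  have 1: "n \<bullet> v = n \<bullet> ?z"
    using assms by (simp add: inner_add_right dot_cross_self inner_commute)
  have 2: "n \<times> v = n \<times> ?z"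
  proof -
    have "n \<times> ?z = (v \<bullet> u) *\<^sub>R (n \<times> u) - (v \<bullet> (n \<times> u)) *\<^sub>R u"
      using cross_orthonormal[OF assms(1,3)]
      by (simp add: cross_add_right cross_mult_right)
    also have "\<dots> = v \<times> (u \<times> (n \<times> u)) + ((n \<times> v) - v \<times> (u \<times> (n \<times> u)))
        + ((v \<bullet> u) *\<^sub>R (n \<times> u) - (v \<bullet> (n \<times> u)) *\<^sub>R u) - (n \<times> v)"
      by simp
    also have "u \<times> (n \<times> u) = n"
      using assms by (simp add: Lagrange un)
    also have "v \<times> n = (v \<bullet> (n \<times> u)) *\<^sub>R u - (v \<bullet> u) *\<^sub>R (n \<times> u)"
      by (metis Lagrange \<open>u \<times> (n \<times> u) = n\<close>)
    finally show ?thesis by (simp add: cross_skew[of n v] \<open>v \<times> n = _\<close>)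
  qed
  show ?thesis using cross_dot_cancel[OF 1 2 nz] .
qed

lemma angular_velocity_ex1:
  fixes n u n' u' :: "real^3"
  assumes o: "n \<bullet> n = 1" "u \<bullet> u = 1" "n \<bullet> u = 0"
    and d: "n \<bullet> n' = 0" "u \<bullet> u' = 0" "n' \<bullet> u + n \<bullet> u' = 0"
  shows "\<exists>!w. u' = w \<times> u \<and> n' \<times> u + n \<times> u' = w \<times> (n \<times> u) \<and> n' = w \<times> n"
proof (rule ex_ex1I)
  define w where "w = n \<times> n' + (u' \<bullet> (n \<times> u)) *\<^sub>R n"
  have "w \<times> n = - (n \<times> (n \<times> n'))"
    by (simp add: w_def cross_add_left cross_mult_left flip: cross_skew[of "n \<times> n'" n])
  then have wn: "w \<times> n = n'"
    using o d by (simp add: Lagrange)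
  have "(n \<times> n') \<times> u = (u' \<bullet> n) *\<^sub>R n"
  proof -
    have "(n \<times> n') \<times> u = - (u \<times> (n \<times> n'))" by (rule cross_skew)
    also have "\<dots> = - ((n' \<bullet> u) *\<^sub>R n)" using o by (simp add: Lagrange inner_commute)
    also have "n' \<bullet> u = - (u' \<bullet> n)" using d(3) by (simp add: inner_commute)
    finally show ?thesis by simp
  qed
  then have "w \<times> u = (u' \<bullet> n) *\<^sub>R n + (u' \<bullet> (n \<times> u)) *\<^sub>R (n \<times> u)"
    by (simp add: w_def cross_add_left cross_mult_left)
  also have "\<dots> = u'"
    using orthonormal_expansion[OF o, of u'] d(2) by (simp add: inner_commute add.commute)
  finally have wu: "w \<times> u = u'" .
  have "n' \<times> u + n \<times> u' = w \<times> (n \<times> u)"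
    unfolding wn[symmetric] wu[symmetric]
    using Jacobi[of w n u] cross_skew[of u w] cross_skew[of u "w \<times> n"]
    by (simp add: algebra_simps)
  then show "\<exists>w. u' = w \<times> u \<and> n' \<times> u + n \<times> u' = w \<times> (n \<times> u) \<and> n' = w \<times> n"
    using wn wu by metis
next
  fix w z
  assume "u' = w \<times> u \<and> n' \<times> u + n \<times> u' = w \<times> (n \<times> u) \<and> n' = w \<times> n"
    and "u' = z \<times> u \<and> n' \<times> u + n \<times> u' = z \<times> (n \<times> u) \<and> n' = z \<times> n"
  then have "(w - z) \<times> u = 0" "(w - z) \<times> n = 0"
    by (auto simp: Cross3.left_diff_distrib)
  then have *: "u \<times> (w - z) = 0" "n \<times> (w - z) = 0"
    using cross_skew[of u "w - z"] cross_skew[of n "w - z"] by auto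
  have "n \<times> (u \<times> (w - z)) = (n \<bullet> (w - z)) *\<^sub>R u - (n \<bullet> u) *\<^sub>R (w - z)"
    by (rule Lagrange)
  then have "(n \<bullet> (w - z)) *\<^sub>R u = 0" using * o by simp
  moreover have "u \<noteq> 0" "n \<noteq> 0" using o by auto
  ultimately have "n \<bullet> (w - z) = 0" by simp
  then have "w - z = 0"
    using * norm_and_cross_eq_0[of n "w - z"] \<open>n \<noteq> 0\<close> by auto
  then show "w = z" by simp
qed

lemma coord_vector_differentiable:
  assumes "local_coordinates S U r" "x \<in> U"
  shows "r differentiable (at x)" "coord_vector r i differentiable (at x)"
proof -
  have "times_differentiable_on (Suc (Suc 0)) U r"
    using assms unfolding local_coordinates_def smooth_on_def by blast
  then show "r differentiable (at x)" "coord_vector r i differentiable (at x)"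
    using assms(2) by (auto simp: coord_vector_def[abs_def])
qed

lemma unit_normal_chart:
  assumes "local_coordinates S U r" "surface_orientation S N" "x \<in> U"
  shows "norm (N (r x)) = 1" "N (r x) \<bullet> coord_vector r i x = 0"
proof -
  have "r x \<in> S"
    using assms(1,3) openin_imp_subset unfolding local_coordinates_def by blast
  moreover have "coord_vector r i x \<in> tangent_plane S (r x)"
    using assms unfolding tangent_plane_def coord_vector_def by blast
  ultimately show "norm (N (r x)) = 1" "N (r x) \<bullet> coord_vector r i x = 0"
    using assms(2) unfolding surface_orientation_def by auto
qed

lemma unit_normal_eq:
  assumes "local_coordinates S U r" "surface_orientation S N"
    "right_handed_coordinates N U r" "x \<in> U"
  shows "coord_vector r 1 x \<times> coord_vector r 2 x \<noteq> 0"
    "N (r x) = sgn (coord_vector r 1 x \<times> coord_vector r 2 x)"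
proof -
  define n where "n = N (r x)"
  define c where "c = coord_vector r 1 x \<times> coord_vector r 2 x"
  have n: "norm n = 1" "n \<bullet> coord_vector r i x = 0" for i
    using unit_normal_chart[OF assms(1,2,4)] by (auto simp: n_def)
  have "coord_vector r 1 x \<bullet> (coord_vector r 2 x \<times> n) > 0"
    using assms(3,4) unfolding dot_cross_det right_handed_coordinates_def n_def by blast
  then have pos: "n \<bullet> c > 0"
    unfolding c_def by (metis cross_triple inner_commute)
  then have c0: "c \<noteq> 0" by auto
  have "n \<times> c = 0"
    by (simp add: c_def Lagrange n(2))
  then have cr: "c \<times> n = c \<times> sgn c"
    using cross_skew[of c n] by (simp add: sgn_div_norm cross_mult_right)
  have "(n \<bullet> c)\<^sup>2 = (norm c)\<^sup>2"
    using norm_cross_dot[of n c] \<open>n \<times> c = 0\<close> n(1) by simp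
  then have "n \<bullet> c = norm c" using pos by (simp add: power2_eq_iff_nonneg)
  then have "c \<bullet> n = c \<bullet> sgn c"
    using c0 by (simp add: sgn_div_norm inner_commute power2_norm_eq_inner[symmetric] power2_eq_square)
  from cross_dot_cancel[OF this cr c0] have "n = sgn c" .
  with c0 show "coord_vector r 1 x \<times> coord_vector r 2 x \<noteq> 0"
    "N (r x) = sgn (coord_vector r 1 x \<times> coord_vector r 2 x)"
    by (simp_all add: n_def c_def)
qed

lemma unit_normal_differentiable:
  assumes "local_coordinates S U r" "surface_orientation S N"
    "right_handed_coordinates N U r" "x \<in> U"
  shows "(\<lambda>y. N (r y)) differentiable (at x)"
proof -
  have "(\<lambda>y. sgn (coord_vector r 1 y \<times> coord_vector r 2 y)) differentiable (at x)"
    by (rule differentiable_sgn[OF differentiable_cross3[OF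
        coord_vector_differentiable(2)[OF assms(1,4)] coord_vector_differentiable(2)[OF assms(1,4)]]
        unit_normal_eq(1)[OF assms]])
  then obtain D where "((\<lambda>y. sgn (coord_vector r 1 y \<times> coord_vector r 2 y)) has_derivative D) (at x)"
    unfolding differentiable_def by blast
  moreover have "open U" using assms(1) by (simp add: local_coordinates_def)
  ultimately have "((\<lambda>y. N (r y)) has_derivative D) (at x)"
    by (rule has_derivative_transform_within_open[OF _ _ assms(4)])
      (simp add: unit_normal_eq(2)[OF assms(1-3)])
  then show ?thesis unfolding differentiable_def by blast
qed

lemma material_radius_facts:
  assumes "local_coordinates S U r" "surface_orientation S N"
    "right_handed_coordinates N U r" "fst q \<in> U"
  shows "material_radius N r q \<bullet> material_radius N r q = 1"
    "N (r (fst q)) \<bullet> material_radius N r q = 0"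
    "material_radius N r differentiable (at q)"
    "(\<lambda>q. N (r (fst q))) differentiable (at q)"
proof -
  define n where "n = N (r (fst q))"
  define e where "e = sgn (coord_vector r 1 (fst q))"
  have c0: "coord_vector r 1 (fst q) \<noteq> 0"
    using unit_normal_eq(1)[OF assms] by auto
  have nn: "n \<bullet> n = 1"
    using unit_normal_chart(1)[OF assms(1,2,4)] by (simp add: n_def norm_eq_1)
  have ne: "n \<bullet> e = 0"
    using unit_normal_chart(2)[OF assms(1,2,4)] by (simp add: n_def e_def sgn_div_norm)
  have ee: "e \<bullet> e = 1"
    using c0 by (simp add: e_def norm_eq_1[symmetric] norm_sgn)
  have bb: "(n \<times> e) \<bullet> (n \<times> e) = 1"
    using cross_orthonormal(3)[OF nn ne] ee by (simp add: power2_norm_eq_inner)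
  have eb: "e \<bullet> (n \<times> e) = 0" "(n \<times> e) \<bullet> e = 0" "n \<bullet> (n \<times> e) = 0"
    by (auto simp: dot_cross_self)
  have u: "material_radius N r q = cos (snd q) *\<^sub>R e + sin (snd q) *\<^sub>R (n \<times> e)"
    by (simp add: material_radius_def n_def e_def Let_def)
  have "material_radius N r q \<bullet> material_radius N r q = (cos (snd q))\<^sup>2 + (sin (snd q))\<^sup>2"
    unfolding u using ee bb eb by (simp add: inner_add_left inner_add_right power2_eq_square)
  then show "material_radius N r q \<bullet> material_radius N r q = 1" by simp
  show "N (r (fst q)) \<bullet> material_radius N r q = 0"
    unfolding u n_def[symmetric] using ne eb by (simp add: inner_add_right)
  have fst: "fst differentiable (at q)" and snd: "snd differentiable (at q)"
    by (auto intro!: bounded_linear_imp_differentiable bounded_linear_fst bounded_linear_snd)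
  show N: "(\<lambda>q. N (r (fst q))) differentiable (at q)"
    using differentiable_chain_at[OF fst unit_normal_differentiable[OF assms]] by (simp add: o_def)
  have c: "(\<lambda>q. coord_vector r 1 (fst q)) differentiable (at q)"
    using differentiable_chain_at[OF fst coord_vector_differentiable(2)[OF assms(1,4)]]
    by (simp add: o_def)
  have e: "(\<lambda>q. sgn (coord_vector r 1 (fst q))) differentiable (at q)"
    by (rule differentiable_sgn[OF c c0])
  have "(\<lambda>q. cos (snd q)) differentiable (at q)" "(\<lambda>q. sin (snd q)) differentiable (at q)"
    using differentiable_chain_at[OF snd, of cos] differentiable_chain_at[OF snd, of sin]
    by (auto simp: o_def intro!: field_differentiable_imp_differentiable
        field_differentiable_at_cos field_differentiable_at_sin)
  then show "material_radius N r differentiable (at q)"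
    unfolding material_radius_def[abs_def] Let_def
    by (intro differentiable_add differentiable_scaleR differentiable_cross3 N e)
qed

lemma angular_velocity_works:
  fixes q qd :: "(real^2) \<times> real"
  assumes "local_coordinates S U r" "surface_orientation S N"
    "right_handed_coordinates N U r" "fst q \<in> U"
  defines "u \<equiv> material_radius N r" and "n \<equiv> \<lambda>q. N (r (fst q))"
    and "w \<equiv> angular_velocity N r q qd"
  shows "frechet_derivative u (at q) qd = w \<times> u q"
    "frechet_derivative (\<lambda>q. n q \<times> u q) (at q) qd = w \<times> (n q \<times> u q)"
    "frechet_derivative n (at q) qd = w \<times> n q"
proof -
  have "open U" using assms(1) by (simp add: local_coordinates_def)
  then have op: "open (fst -` U :: ((real^2) \<times> real) set)"
    by (intro open_vimage continuous_on_fst continuous_on_id)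
  have fact: "u p \<bullet> u p = 1" "n p \<bullet> u p = 0" "n p \<bullet> n p = 1"
    "u differentiable (at p)" "n differentiable (at p)" if "fst p \<in> U" for p
    using material_radius_facts[OF assms(1-3) that] unit_normal_chart(1)[OF assms(1,2) that]
    by (auto simp: u_def n_def norm_eq_1)
  define u' where "u' = frechet_derivative u (at q)"
  define n' where "n' = frechet_derivative n (at q)"
  have u': "(u has_derivative u') (at q)" and n': "(n has_derivative n') (at q)"
    using fact[OF assms(4)] by (auto simp: u'_def n'_def frechet_derivative_works)
  have const: "f' qd = 0" if "(f has_derivative f') (at q)" "\<And>p. fst p \<in> U \<Longrightarrow> f p = c"
    for f :: "_ \<Rightarrow> real" and f' c
  proof -
    have "((\<lambda>_. c) has_derivative f') (at q)"
      by (rule has_derivative_transform_within_open[OF that(1) op]) (use assms(4) that(2) in auto)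
    from has_derivative_unique[OF this has_derivative_const] show ?thesis by simp
  qed
  have d: "n q \<bullet> n' qd = 0" "u q \<bullet> u' qd = 0" "n' qd \<bullet> u q + n q \<bullet> u' qd = 0"
  proof -
    have "n q \<bullet> n' qd + n' qd \<bullet> n q = 0"
      by (rule const[OF has_derivative_inner[OF n' n']]) (rule fact(3))
    then show "n q \<bullet> n' qd = 0" by (simp add: inner_commute)
    have "u q \<bullet> u' qd + u' qd \<bullet> u q = 0"
      by (rule const[OF has_derivative_inner[OF u' u']]) (rule fact(1))
    then show "u q \<bullet> u' qd = 0" by (simp add: inner_commute)
    have "n q \<bullet> u' qd + n' qd \<bullet> u q = 0"
      by (rule const[OF has_derivative_inner[OF n' u']]) (rule fact(2))
    then show "n' qd \<bullet> u q + n q \<bullet> u' qd = 0" by simp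
  qed
  have b: "frechet_derivative (\<lambda>q. n q \<times> u q) (at q) qd = n' qd \<times> u q + n q \<times> u' qd"
    unfolding frechet_derivative_at[OF bounded_bilinear.FDERIV[OF bounded_bilinear_cross3 n' u'],
        symmetric]
    by (rule add.commute)
  have "w = (THE w. u' qd = w \<times> u q \<and> n' qd \<times> u q + n q \<times> u' qd = w \<times> (n q \<times> u q) \<and>
      n' qd = w \<times> n q)"
    unfolding w_def angular_velocity_def Let_def b[unfolded u_def n_def] u'_def u_def n'_def n_def
    by simp
  with theI'[OF angular_velocity_ex1[OF fact(3,1,2)[OF assms(4)] d]]
  have "u' qd = w \<times> u q \<and> n' qd \<times> u q + n q \<times> u' qd = w \<times> (n q \<times> u q) \<and> n' qd = w \<times> n q"
    by simp
  then show "frechet_derivative u (at q) qd = w \<times> u q"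
    "frechet_derivative (\<lambda>q. n q \<times> u q) (at q) qd = w \<times> (n q \<times> u q)"
    "frechet_derivative n (at q) qd = w \<times> n q"
    using b by (auto simp: u'_def n'_def)
qed

lemma angular_velocity_along_curve:
  fixes q :: "real \<Rightarrow> (real^2) \<times> real" and qd :: "(real^2) \<times> real"
  assumes "local_coordinates S U r" "surface_orientation S N"
    "right_handed_coordinates N U r" "fst (q t) \<in> U"
    and q: "(q has_vector_derivative qd) (at t)"
  defines "w \<equiv> angular_velocity N r (q t) qd"
  shows "((\<lambda>s. material_radius N r (q s)) has_vector_derivative
            w \<times> material_radius N r (q t)) (at t)"
    "((\<lambda>s. N (r (fst (q s))) \<times> material_radius N r (q s)) has_vector_derivative
        w \<times> (N (r (fst (q t))) \<times> material_radius N r (q t))) (at t)"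
    "((\<lambda>s. N (r (fst (q s)))) has_vector_derivative w \<times> N (r (fst (q t)))) (at t)"
proof -
  have chain: "((\<lambda>s. f (q s)) has_vector_derivative frechet_derivative f (at (q t)) qd) (at t)"
    if "f differentiable (at (q t))" for f :: "(real^2) \<times> real \<Rightarrow> real^3"
    using vector_derivative_diff_chain_within[of q qd t UNIV f]
      has_derivative_at_withinI[OF that[unfolded frechet_derivative_works]] q
    by (auto simp: o_def)
  note m = material_radius_facts[OF assms(1-4)]
  note av = angular_velocity_works[OF assms(1-4), of qd, folded w_def]
  show "((\<lambda>s. material_radius N r (q s)) has_vector_derivative
            w \<times> material_radius N r (q t)) (at t)"
    using chain[OF m(3)] av(1) by simp
  show "((\<lambda>s. N (r (fst (q s))) \<times> material_radius N r (q s)) has_vector_derivative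
        w \<times> (N (r (fst (q t))) \<times> material_radius N r (q t))) (at t)"
    using chain[OF differentiable_cross3[OF m(4,3)]] av(2) by simp
  show "((\<lambda>s. N (r (fst (q s)))) has_vector_derivative w \<times> N (r (fst (q t)))) (at t)"
    using chain[OF m(4)] av(3) by simp
qed

lemma diametral_velocity_sq:
  assumes "local_coordinates S U r" "surface_orientation S N"
    "right_handed_coordinates N U r" "x \<in> U"
  shows "(diametral_velocity N r (x, \<theta>) (xd, \<theta>d))\<^sup>2
    = (norm (frechet_derivative (\<lambda>y. N (r y)) (at x) xd))\<^sup>2"
proof -
  define w where "w = angular_velocity N r (x, \<theta>) (xd, \<theta>d)"
  define n where "n = N (r x)"
  have x: "fst (x, \<theta>) \<in> U" using assms(4) by simp
  have nn: "n \<bullet> n = 1"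
    using unit_normal_chart(1)[OF assms(1,2,4)] by (simp add: n_def norm_eq_1)
  have "((\<lambda>y. N (r y)) \<circ> fst has_derivative frechet_derivative (\<lambda>y. N (r y)) (at x) \<circ> fst)
      (at (x, \<theta>))"
    using unit_normal_differentiable[OF assms]
    by (intro diff_chain_at bounded_linear_imp_has_derivative bounded_linear_fst)
      (simp add: frechet_derivative_works)
  from frechet_derivative_at[OF this]
  have "frechet_derivative (\<lambda>q. N (r (fst q))) (at (x, \<theta>)) (xd, \<theta>d)
      = frechet_derivative (\<lambda>y. N (r y)) (at x) xd"
    by (simp add: o_def fun_eq_iff)
  with angular_velocity_works(3)[OF assms(1-3) x, of "(xd, \<theta>d)"]
  have "frechet_derivative (\<lambda>y. N (r y)) (at x) xd = w \<times> n"
    by (simp add: w_def n_def)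
  moreover have "(norm (w \<times> n))\<^sup>2 = (norm (w - (w \<bullet> n) *\<^sub>R n))\<^sup>2"
    unfolding norm_cross unfolding power2_norm_eq_inner
    using nn by (simp add: inner_diff_left inner_diff_right inner_commute[of n w] power2_eq_square)
  ultimately show ?thesis
    by (simp add: diametral_velocity_def axial_velocity_def w_def n_def)
qed

unbundle no cross3_syntax

end

theory Submission
  imports Defs
begin

text \<open>Let \<open>e\<^sub>1 = sgn (\<partial>\<^sub>1 r)\<close>, \<open>n\<close> the normal and \<open>e\<^sub>2 = n \<times> e\<^sub>1\<close>, an orthonormal frame that moves
  along the chart. Turning this frame by \<open>\<theta>\<close> in the tangent plane adds the rate of \<open>\<theta>\<close> to the
  rotation of the frame itself, so \<open>\<omega>\<^sub>a = \<theta>' + A(x) \<bullet> x'\<close>, where \<open>A\<close> is the connection form of the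
  frame: \<open>A(x) \<bullet> v = \<langle>de\<^sub>1(v), e\<^sub>2\<rangle>\<close> (\<open>axial_velocity_eq\<close>). Since \<open>\<omega>\<^sub>d\<close> does not involve \<open>\<theta>\<close>,
  the Lagrangian is \<open>T(x, x') + I\<^sub>a/2 (\<theta>' + A(x) \<bullet> x')\<^sup>2\<close>.

  For every Lagrangian of this shape \<open>\<theta>\<close> is cyclic, so its momentum \<open>L = I\<^sub>a \<omega>\<^sub>a\<close> is conserved, and
  what remains of the Euler--Lagrange equations is the motion of a particle with Lagrangian \<open>T\<close>
  and charge \<open>L\<close> in a magnetic field with vector potential \<open>A\<close>. The component of the force
  on it in a direction \<open>h\<close> is \<open>L dA(h, x')\<close> (\<open>magnetic_euler_lagrange\<close>).

  The geometry lies in the identification of that magnetic field. By the symmetry of second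
  derivatives, the second derivatives of \<open>e\<^sub>1\<close> cancel in \<open>dA\<close>, and what is left is minus the
  oriented area spanned by two derivatives of \<open>n\<close>, that is, minus the pullback of the area form
  of the sphere under the Gauss map (\<open>curl_connection_form\<close>). The Gauss map multiplies area by
  \<open>K\<close> (\<open>gauss_map_area\<close>), and in orthogonal coordinates the area form is
  \<open>\<surd>(a\<^sub>1\<^sub>1 a\<^sub>2\<^sub>2) dx\<^sub>1 \<and> dx\<^sub>2\<close>.\<close>

section \<open>Symmetry of second derivatives\<close>

text \<open>The second difference over a small parallelogram with sides \<open>h v\<close> and \<open>h w\<close> is the increment
  over \<open>[0, h]\<close> of \<open>t \<mapsto> f (x + t v + h w) - f (x + t v)\<close>. The mean value theorem turns it into \<open>h\<close>
  times a difference of two values of \<open>D _ v\<close> near \<open>x\<close>, to which differentiability of \<open>D _ v\<close> at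
  the single point \<open>x\<close> applies.\<close>

lemma second_difference_estimate:
  fixes f :: "'a::real_normed_vector \<Rightarrow> real"
  assumes "open U" "x \<in> U"
    and f: "\<And>y. y \<in> U \<Longrightarrow> (f has_derivative D y) (at y)"
    and Dv: "((\<lambda>y. D y v) has_derivative Dv) (at x)"
    and "\<epsilon> > 0"
  obtains \<delta> where "\<delta> > 0"
    "\<And>h. 0 < h \<Longrightarrow> h < \<delta> \<Longrightarrow>
      \<bar>f (x + h *\<^sub>R v + h *\<^sub>R w) - f (x + h *\<^sub>R v) - f (x + h *\<^sub>R w) + f x - h\<^sup>2 * Dv w\<bar> \<le> \<epsilon> * h\<^sup>2"
proof -
  define M where "M = norm v + norm w + 1"
  have M: "M > 0" "norm v + norm w < M" by (auto simp: M_def add_nonneg_pos)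
  obtain r where r: "r > 0" "\<And>y. norm (y - x) < r \<Longrightarrow> y \<in> U"
    using assms(1,2) by (metis openE mem_ball dist_commute dist_norm subset_iff)
  have "0 < \<epsilon> / (2 * M)" using M \<open>\<epsilon> > 0\<close> by simp
  with Dv obtain d where d: "d > 0" "\<And>y. norm (y - x) < d \<Longrightarrow>
      \<bar>D y v - D x v - Dv (y - x)\<bar> \<le> \<epsilon> / (2 * M) * norm (y - x)"
    unfolding has_derivative_at_alt real_norm_def by metis
  interpret Dv: bounded_linear Dv using Dv by (rule has_derivative_bounded_linear)
  show ?thesis
  proof (rule that)
    show "min r d / M > 0" using M r d by simp
    fix h :: real
    assume h: "0 < h" "h < min r d / M"
    then have hM: "h * M < r" "h * M < d" using M by (auto simp: field_simps)
    \<comment> \<open>The mean value theorem is applied to the difference of \<open>f\<close> between the two sides parallel to \<open>v\<close>.\<close>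
    define g where "g t = f (x + t *\<^sub>R v + h *\<^sub>R w) - f (x + t *\<^sub>R v)" for t :: real
    have small: "norm (t *\<^sub>R v + s *\<^sub>R w) \<le> h * M" if "0 \<le> t" "t \<le> h" "0 \<le> s" "s \<le> h" for t s
    proof -
      have "norm (t *\<^sub>R v + s *\<^sub>R w) \<le> t * norm v + s * norm w"
        using norm_triangle_ineq[of "t *\<^sub>R v" "s *\<^sub>R w"] that by simp
      also have "\<dots> \<le> h * norm v + h * norm w"
        using that by (intro add_mono mult_right_mono) auto
      also have "\<dots> \<le> h * M" using M h by (simp add: flip: distrib_left)
      finally show ?thesis .
    qed
    have small1: "norm (t *\<^sub>R v) \<le> h * M" if "0 \<le> t" "t \<le> h" for t
      using small[of t 0] that h by simp
    have g': "(g has_derivative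
        (\<lambda>k. D (x + t *\<^sub>R v + h *\<^sub>R w) (k *\<^sub>R v) - D (x + t *\<^sub>R v) (k *\<^sub>R v))) (at t)"
      if "0 \<le> t" "t \<le> h" for t
    proof -
      have "x + t *\<^sub>R v + h *\<^sub>R w \<in> U"
        by (rule r(2)) (use small[of t h] that h hM in \<open>auto simp: algebra_simps\<close>)
      moreover have "x + t *\<^sub>R v \<in> U"
        by (rule r(2)) (use small1[of t] that h hM in auto)
      moreover have "((\<lambda>t. x + t *\<^sub>R v + h *\<^sub>R w) has_derivative (\<lambda>k. k *\<^sub>R v)) (at t)"
        "((\<lambda>t. x + t *\<^sub>R v) has_derivative (\<lambda>k. k *\<^sub>R v)) (at t)"
        by (auto intro!: derivative_eq_intros)
      ultimately show ?thesis unfolding g_def[abs_def]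
        by (intro has_derivative_diff has_derivative_compose[OF _ f])
    qed
    have "\<exists>t\<in>{0<..<h}. g h - g 0 =
        D (x + t *\<^sub>R v + h *\<^sub>R w) ((h - 0) *\<^sub>R v) - D (x + t *\<^sub>R v) ((h - 0) *\<^sub>R v)"
    proof (rule mvt_simple[OF h(1)])
      fix t assume "0 \<le> t" "t \<le> h"
      then show "(g has_derivative (\<lambda>k. D (x + t *\<^sub>R v + h *\<^sub>R w) (k *\<^sub>R v)
          - D (x + t *\<^sub>R v) (k *\<^sub>R v))) (at t within {0..h})"
        by (rule has_derivative_at_withinI[OF g'])
    qed
    then obtain t where t: "0 < t" "t < h" and
      "g h - g 0 = D (x + t *\<^sub>R v + h *\<^sub>R w) (h *\<^sub>R v) - D (x + t *\<^sub>R v) (h *\<^sub>R v)"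
      by auto
    moreover have "x + t *\<^sub>R v + h *\<^sub>R w \<in> U"
      by (rule r(2)) (use small[of t h] t h hM in \<open>auto simp: algebra_simps\<close>)
    moreover have "x + t *\<^sub>R v \<in> U"
      by (rule r(2)) (use small1[of t] t h hM in auto)
    ultimately have gh: "g h - g 0 = h * (D (x + t *\<^sub>R v + h *\<^sub>R w) v - D (x + t *\<^sub>R v) v)"
      using has_derivative_linear[OF f] by (simp add: linear_cmul right_diff_distrib)
    have "\<bar>D (x + t *\<^sub>R v + h *\<^sub>R w) v - D x v - Dv (t *\<^sub>R v + h *\<^sub>R w)\<bar>
        \<le> \<epsilon> / (2 * M) * norm (t *\<^sub>R v + h *\<^sub>R w)"
      using d(2)[of "x + t *\<^sub>R v + h *\<^sub>R w"] small[of t h] t h hM by (simp add: add.assoc)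
    also have "\<dots> \<le> \<epsilon> / (2 * M) * (h * M)"
      using small[of t h] t h M \<open>\<epsilon> > 0\<close> by (intro mult_left_mono) auto
    finally have 1: "\<bar>D (x + t *\<^sub>R v + h *\<^sub>R w) v - D x v - Dv (t *\<^sub>R v + h *\<^sub>R w)\<bar> \<le> \<epsilon> * h / 2"
      using M by (simp add: field_simps)
    have "\<bar>D (x + t *\<^sub>R v) v - D x v - Dv (t *\<^sub>R v)\<bar> \<le> \<epsilon> / (2 * M) * norm (t *\<^sub>R v)"
      using d(2)[of "x + t *\<^sub>R v"] small1[of t] t h hM by simp
    also have "\<dots> \<le> \<epsilon> / (2 * M) * (h * M)"
      using small1[of t] t h M \<open>\<epsilon> > 0\<close> by (intro mult_left_mono) auto
    finally have 2: "\<bar>D (x + t *\<^sub>R v) v - D x v - Dv (t *\<^sub>R v)\<bar> \<le> \<epsilon> * h / 2"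
      using M by (simp add: field_simps)
    have "\<bar>D (x + t *\<^sub>R v + h *\<^sub>R w) v - D (x + t *\<^sub>R v) v - h * Dv w\<bar> \<le> \<epsilon> * h"
      using 1 2 unfolding Dv.add Dv.scaleR real_scaleR_def abs_le_iff by linarith
    then have "h * \<bar>D (x + t *\<^sub>R v + h *\<^sub>R w) v - D (x + t *\<^sub>R v) v - h * Dv w\<bar> \<le> h * (\<epsilon> * h)"
      using h by (intro mult_left_mono) auto
    then have "\<bar>h * (D (x + t *\<^sub>R v + h *\<^sub>R w) v - D (x + t *\<^sub>R v) v - h * Dv w)\<bar> \<le> h * (\<epsilon> * h)"
      using h by (simp add: abs_mult)
    moreover have "h * (D (x + t *\<^sub>R v + h *\<^sub>R w) v - D (x + t *\<^sub>R v) v - h * Dv w)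
        = g h - g 0 - h\<^sup>2 * Dv w"
      unfolding gh by (simp add: algebra_simps power2_eq_square)
    ultimately show "\<bar>f (x + h *\<^sub>R v + h *\<^sub>R w) - f (x + h *\<^sub>R v) - f (x + h *\<^sub>R w) + f x - h\<^sup>2 * Dv w\<bar>
        \<le> \<epsilon> * h\<^sup>2"
      by (simp add: g_def power2_eq_square mult.left_commute)
  qed
qed

text \<open>Young's theorem. The second difference does not change when \<open>v\<close> and \<open>w\<close> are exchanged, so both
  mixed derivatives are its limit after division by \<open>h\<^sup>2\<close>.\<close>

lemma second_derivative_symmetric:
  fixes f :: "'a::real_normed_vector \<Rightarrow> 'b::real_inner"
  assumes "open U" "x \<in> U"
    and f: "\<And>y. y \<in> U \<Longrightarrow> (f has_derivative D y) (at y)"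
    and Dv: "((\<lambda>y. D y v) has_derivative Dv) (at x)"
    and Dw: "((\<lambda>y. D y w) has_derivative Dw) (at x)"
  shows "Dv w = Dw v"
proof -
  \<comment> \<open>A vector valued map is reduced to a real one by pairing it with the difference to be shown zero.\<close>
  define b where "b = Dv w - Dw v"
  have fb: "((\<lambda>y. f y \<bullet> b) has_derivative (\<lambda>h. D y h \<bullet> b)) (at y)" if "y \<in> U" for y
    by (rule has_derivative_inner_left[OF f[OF that]])
  have "\<bar>Dv w \<bullet> b - Dw v \<bullet> b\<bar> \<le> \<epsilon>" if "\<epsilon> > 0" for \<epsilon>
  proof -
    have "\<epsilon> / 2 > 0" using that by simp
    obtain \<delta>1 where \<delta>1: "\<delta>1 > 0" "\<And>h. 0 < h \<Longrightarrow> h < \<delta>1 \<Longrightarrow>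
      \<bar>f (x + h *\<^sub>R v + h *\<^sub>R w) \<bullet> b - f (x + h *\<^sub>R v) \<bullet> b - f (x + h *\<^sub>R w) \<bullet> b + f x \<bullet> b
        - h\<^sup>2 * (Dv w \<bullet> b)\<bar> \<le> \<epsilon> / 2 * h\<^sup>2"
      using second_difference_estimate[OF assms(1,2) fb has_derivative_inner_left[OF Dv] \<open>\<epsilon> / 2 > 0\<close>]
      by blast
    obtain \<delta>2 where \<delta>2: "\<delta>2 > 0" "\<And>h. 0 < h \<Longrightarrow> h < \<delta>2 \<Longrightarrow>
      \<bar>f (x + h *\<^sub>R w + h *\<^sub>R v) \<bullet> b - f (x + h *\<^sub>R w) \<bullet> b - f (x + h *\<^sub>R v) \<bullet> b + f x \<bullet> b
        - h\<^sup>2 * (Dw v \<bullet> b)\<bar> \<le> \<epsilon> / 2 * h\<^sup>2"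
      using second_difference_estimate[OF assms(1,2) fb has_derivative_inner_left[OF Dw] \<open>\<epsilon> / 2 > 0\<close>]
      by blast
    define h where "h = min \<delta>1 \<delta>2 / 2"
    have h: "0 < h" "h < \<delta>1" "h < \<delta>2" using \<delta>1(1) \<delta>2(1) by (auto simp: h_def)
    have "\<bar>h\<^sup>2 * (Dv w \<bullet> b) - h\<^sup>2 * (Dw v \<bullet> b)\<bar> \<le> \<epsilon> * h\<^sup>2"
      using \<delta>1(2)[OF h(1,2)] \<delta>2(2)[OF h(1,3)]
      unfolding add.assoc add.commute[of "h *\<^sub>R w"] abs_le_iff by linarith
    then have "\<bar>h\<^sup>2 * (Dv w \<bullet> b - Dw v \<bullet> b)\<bar> \<le> h\<^sup>2 * \<epsilon>"
      by (simp only: right_diff_distrib mult.commute[of \<epsilon>])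
    then have "h\<^sup>2 * \<bar>Dv w \<bullet> b - Dw v \<bullet> b\<bar> \<le> h\<^sup>2 * \<epsilon>"
      by (simp only: abs_mult abs_power2)
    then show ?thesis using h by simp
  qed
  then have "\<bar>Dv w \<bullet> b - Dw v \<bullet> b\<bar> \<le> 0"
    by (rule field_le_epsilon[of _ 0, simplified])
  then have "b \<bullet> b = 0" by (simp add: b_def inner_diff_left)
  then show ?thesis by (simp add: b_def)
qed

section \<open>Lagrangians with a cyclic angle and a vector potential\<close>

lemma has_derivative_gradient:
  fixes f :: "'a::euclidean_space \<Rightarrow> real"
  assumes "f differentiable (at x)"
  shows "(f has_derivative (\<lambda>v. gradient f x \<bullet> v)) (at x)"
proof -
  have f: "(f has_derivative frechet_derivative f (at x)) (at x)"
    using assms by (simp add: frechet_derivative_works)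
  have "frechet_derivative f (at x) v = gradient f x \<bullet> v" for v
  proof -
    have "frechet_derivative f (at x) v = frechet_derivative f (at x) (\<Sum>b\<in>Basis. (v \<bullet> b) *\<^sub>R b)"
      by (simp add: euclidean_representation)
    also have "\<dots> = (\<Sum>b\<in>Basis. (v \<bullet> b) * frechet_derivative f (at x) b)"
      using has_derivative_linear[OF f] by (simp add: linear_sum linear_cmul)
    also have "\<dots> = gradient f x \<bullet> v"
      by (simp add: gradient_def inner_sum_left inner_commute[of v] mult.commute)
    finally show ?thesis .
  qed
  then have "frechet_derivative f (at x) = (\<lambda>v. gradient f x \<bullet> v)" by (rule ext)
  with f show ?thesis by simp
qed

lemma gradient_eqI:
  fixes f :: "'a::euclidean_space \<Rightarrow> real"
  assumes "(f has_derivative (\<lambda>v. g \<bullet> v)) (at x)"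
  shows "gradient f x = g"
proof -
  have "frechet_derivative f (at x) = (\<lambda>v. g \<bullet> v)"
    by (rule frechet_derivative_at[OF assms, symmetric])
  then show ?thesis by (simp add: gradient_def euclidean_representation)
qed

text \<open>Write \<open>p = I (\<theta>' + A \<bullet> x')\<close>. The momenta of \<open>E\<close> are \<open>(T\<^sub>v + p A, p)\<close> and the generalized forces
  are \<open>(T\<^sub>x + p (DA)\<^sup>* x', 0)\<close>. The last component says that \<open>p\<close> is a constant \<open>L\<close>. In the first
  one the momentum \<open>L A(x(t))\<close> is differentiable by the chain rule with derivative \<open>L DA x'\<close>, and
  moving it to the other side leaves \<open>L ((DA)\<^sup>* - DA) x'\<close>, the magnetic force.\<close>

lemma magnetic_euler_lagrange:
  fixes T :: "'a::euclidean_space \<Rightarrow> 'a \<Rightarrow> real" and A :: "'a \<Rightarrow> 'a"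
    and E :: "'a \<times> real \<Rightarrow> 'a \<times> real \<Rightarrow> real"
  assumes "open U"
    and E: "\<And>y \<alpha> v \<beta>. y \<in> U \<Longrightarrow> E (y, \<alpha>) (v, \<beta>) = T y v + 1/2 * I * (\<beta> + A y \<bullet> v)\<^sup>2"
    and T_pos: "\<And>y v. y \<in> U \<Longrightarrow> (\<lambda>z. T z v) differentiable (at y)"
    and T_vel: "\<And>y v. y \<in> U \<Longrightarrow> T y differentiable (at v)"
    and A: "\<And>y. y \<in> U \<Longrightarrow> (A has_derivative A' y) (at y)"
    and "open \<I>" "is_interval \<I>"
    and motion: "euler_lagrange_solution E (U \<times> UNIV) \<I> (\<lambda>t. (x t, \<theta> t))"
  obtains L where
    "\<And>t. t \<in> \<I> \<Longrightarrow> I * (velocity \<theta> t + A (x t) \<bullet> velocity x t) = L"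
    "\<And>t. t \<in> \<I> \<Longrightarrow> ((\<lambda>s. vel_gradient T (x s) (velocity x s)) has_vector_derivative
        pos_gradient T (x t) (velocity x t)
          + L *\<^sub>R (adjoint (A' (x t)) (velocity x t) - A' (x t) (velocity x t))) (at t)"
proof -
  define p where "p t = I * (velocity \<theta> t + A (x t) \<bullet> velocity x t)" for t
  have U: "x t \<in> U" if "t \<in> \<I>" for t
    using motion that by (auto simp: euler_lagrange_solution_def)
  have x': "(x has_vector_derivative velocity x t) (at t)"
    and \<theta>': "(\<theta> has_vector_derivative velocity \<theta> t) (at t)"
    and q': "velocity (\<lambda>t. (x t, \<theta> t)) t = (velocity x t, velocity \<theta> t)" if "t \<in> \<I>" for t
  proof -
    have "(\<lambda>t. (x t, \<theta> t)) differentiable (at t)"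
      using motion that by (auto simp: euler_lagrange_solution_def)
    then have "((\<lambda>t. (x t, \<theta> t)) has_vector_derivative velocity (\<lambda>t. (x t, \<theta> t)) t) (at t)"
      by (simp add: vector_derivative_works)
    then obtain a b where ab: "((\<lambda>t. (x t, \<theta> t)) has_vector_derivative (a, b)) (at t)"
      by (metis surj_pair)
    have "(x has_vector_derivative a) (at t)" "(\<theta> has_vector_derivative b) (at t)"
      using has_derivative_fst[OF ab[unfolded has_vector_derivative_def]]
        has_derivative_snd[OF ab[unfolded has_vector_derivative_def]]
      by (auto simp: has_vector_derivative_def)
    then show "(x has_vector_derivative velocity x t) (at t)"
      "(\<theta> has_vector_derivative velocity \<theta> t) (at t)"
      "velocity (\<lambda>t. (x t, \<theta> t)) t = (velocity x t, velocity \<theta> t)"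
      using vector_derivative_at ab by (metis)+
  qed
  have vel: "vel_gradient E (y, \<alpha>) (v, \<beta>)
      = (vel_gradient T y v + (I * (\<beta> + A y \<bullet> v)) *\<^sub>R A y, I * (\<beta> + A y \<bullet> v))"
    if "y \<in> U" for y \<alpha> v \<beta>
  proof -
    have Ey: "E (y, \<alpha>) = (\<lambda>w. T y (fst w) + 1/2 * I * (snd w + A y \<bullet> fst w)\<^sup>2)"
      using E[OF that] by (auto simp: fun_eq_iff)
    have "(T y has_derivative (\<lambda>h. vel_gradient T y v \<bullet> h)) (at (fst (v, \<beta>)))"
      using has_derivative_gradient[OF T_vel[OF that]] by (simp add: vel_gradient_def)
    then have 1: "((\<lambda>w. T y (fst w)) has_derivative (\<lambda>h. vel_gradient T y v \<bullet> fst h)) (at (v, \<beta>))"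
      by (rule has_derivative_compose[rotated]) (auto intro!: derivative_eq_intros)
    have "(E (y, \<alpha>) has_derivative (\<lambda>h.
        (vel_gradient T y v + (I * (\<beta> + A y \<bullet> v)) *\<^sub>R A y, I * (\<beta> + A y \<bullet> v)) \<bullet> h)) (at (v, \<beta>))"
      unfolding Ey
      by (rule derivative_eq_intros 1 refl)+
        (auto simp: fun_eq_iff inner_prod_def algebra_simps)
    then show ?thesis unfolding vel_gradient_def[of E] by (intro gradient_eqI) simp
  qed
  have pos: "pos_gradient E (y, \<alpha>) (v, \<beta>)
      = (pos_gradient T y v + (I * (\<beta> + A y \<bullet> v)) *\<^sub>R adjoint (A' y) v, 0)"
    if "y \<in> U" for y \<alpha> v \<beta>
  proof -
    have lin: "linear (A' y)" using A[OF that] by (rule has_derivative_linear)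
    have "((\<lambda>z. T z v) has_derivative (\<lambda>h. pos_gradient T y v \<bullet> h)) (at (fst (y, \<alpha>)))"
      using has_derivative_gradient[OF T_pos[OF that]] by (simp add: pos_gradient_def)
    then have 1: "((\<lambda>q. T (fst q) v) has_derivative (\<lambda>h. pos_gradient T y v \<bullet> fst h)) (at (y, \<alpha>))"
      by (rule has_derivative_compose[rotated]) (auto intro!: derivative_eq_intros)
    have "(A has_derivative A' y) (at (fst (y, \<alpha>)))" using A[OF that] by simp
    then have 2: "((\<lambda>q. A (fst q)) has_derivative (\<lambda>h. A' y (fst h))) (at (y, \<alpha>))"
      by (rule has_derivative_compose[rotated]) (auto intro!: derivative_eq_intros)
    have "((\<lambda>q. T (fst q) v + 1/2 * I * (\<beta> + A (fst q) \<bullet> v)\<^sup>2) has_derivative (\<lambda>h.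
        (pos_gradient T y v + (I * (\<beta> + A y \<bullet> v)) *\<^sub>R adjoint (A' y) v, 0) \<bullet> h)) (at (y, \<alpha>))"
      by (rule derivative_eq_intros 1 2 refl)+
        (auto simp: fun_eq_iff inner_prod_def algebra_simps adjoint_works[OF lin]
          inner_commute[of "adjoint _ _"])
    moreover have "open (U \<times> (UNIV :: real set))" using \<open>open U\<close> by (intro open_Times) auto
    ultimately have "((\<lambda>q. E q (v, \<beta>)) has_derivative (\<lambda>h.
        (pos_gradient T y v + (I * (\<beta> + A y \<bullet> v)) *\<^sub>R adjoint (A' y) v, 0) \<bullet> h)) (at (y, \<alpha>))"
      by (rule has_derivative_transform_within_open[of _ _ _ _ "U \<times> UNIV"])
        (use that E in auto)
    then show ?thesis unfolding pos_gradient_def[of E] by (rule gradient_eqI)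
  qed
  \<comment> \<open>The Euler--Lagrange equations of \<open>E\<close>, both components at once.\<close>
  have EL: "((\<lambda>s. (vel_gradient T (x s) (velocity x s) + p s *\<^sub>R A (x s), p s)) has_vector_derivative
      (pos_gradient T (x t) (velocity x t) + p t *\<^sub>R adjoint (A' (x t)) (velocity x t), 0)) (at t)"
    if "t \<in> \<I>" for t
  proof (rule has_vector_derivative_transform_within_open[OF _ \<open>open \<I>\<close> that])
    show "((\<lambda>s. vel_gradient E (x s, \<theta> s) (velocity (\<lambda>t. (x t, \<theta> t)) s)) has_vector_derivative
        (pos_gradient T (x t) (velocity x t) + p t *\<^sub>R adjoint (A' (x t)) (velocity x t), 0)) (at t)"
      using motion that by (auto simp: euler_lagrange_solution_def q' pos U p_def)
  qed (simp add: q' vel U p_def)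
  have "(p has_vector_derivative 0) (at t)" if "t \<in> \<I>" for t
    using has_derivative_snd[OF EL[OF that, unfolded has_vector_derivative_def]]
    by (simp add: has_vector_derivative_def)
  then obtain L where L: "p t = L" if "t \<in> \<I>" for t
    using has_vector_derivative_zero_constant[of \<I> p] \<open>is_interval \<I>\<close>
    by (metis has_vector_derivative_at_within is_interval_convex)
  show ?thesis
  proof
    fix t assume t: "t \<in> \<I>"
    show "I * (velocity \<theta> t + A (x t) \<bullet> velocity x t) = L" using L[OF t] by (simp add: p_def)
    have "((\<lambda>s. A (x s)) has_vector_derivative A' (x t) (velocity x t)) (at t)"
      using vector_derivative_diff_chain_within[OF x'[OF t], of A "A' (x t)"] A[OF U[OF t]]
      by (auto simp: o_def has_derivative_at_withinI)
    moreover have "((\<lambda>s. vel_gradient T (x s) (velocity x s) + p s *\<^sub>R A (x s)) has_vector_derivative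
        pos_gradient T (x t) (velocity x t) + L *\<^sub>R adjoint (A' (x t)) (velocity x t)) (at t)"
      using has_derivative_fst[OF EL[OF t, unfolded has_vector_derivative_def]] L[OF t]
      by (simp add: has_vector_derivative_def)
    ultimately have "((\<lambda>s. vel_gradient T (x s) (velocity x s) + p s *\<^sub>R A (x s) - L *\<^sub>R A (x s))
        has_vector_derivative pos_gradient T (x t) (velocity x t)
          + L *\<^sub>R adjoint (A' (x t)) (velocity x t) - L *\<^sub>R A' (x t) (velocity x t)) (at t)"
      using has_vector_derivative_diff
        bounded_linear.has_vector_derivative[OF bounded_linear_scaleR_right[of L]] by blast
    then have "((\<lambda>s. vel_gradient T (x s) (velocity x s)) has_vector_derivative
        pos_gradient T (x t) (velocity x t)
          + L *\<^sub>R adjoint (A' (x t)) (velocity x t) - L *\<^sub>R A' (x t) (velocity x t)) (at t)"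
      by (rule has_vector_derivative_transform_within_open[OF _ \<open>open \<I>\<close> t]) (simp add: L)
    then show "((\<lambda>s. vel_gradient T (x s) (velocity x s)) has_vector_derivative
        pos_gradient T (x t) (velocity x t)
          + L *\<^sub>R (adjoint (A' (x t)) (velocity x t) - A' (x t) (velocity x t))) (at t)"
      by (simp add: scaleR_diff_right add_diff_eq)
  qed
qed

section \<open>Twice differentiable vector fields\<close>

unbundle cross3_syntax

lemma dot_cross_cross:
  fixes a b c d :: "real^3"
  shows "(a \<times> b) \<bullet> (c \<times> d) = (a \<bullet> c) * (b \<bullet> d) - (a \<bullet> d) * (b \<bullet> c)"
  by (simp add: cross3_simps)

text \<open>This is the regularity under which \<open>second_derivative_symmetric\<close> applies at every point. Asking
  only for derivatives in fixed directions \<open>v\<close> avoids a norm on the space of linear maps.\<close>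

definition twice_differentiable_on ::
    "'a::real_normed_vector set \<Rightarrow> ('a \<Rightarrow> 'b::real_normed_vector) \<Rightarrow> bool" where
  "twice_differentiable_on U f \<longleftrightarrow> (\<forall>y\<in>U. f differentiable (at y) \<and>
     (\<forall>v. (\<lambda>z. frechet_derivative f (at z) v) differentiable (at y)))"

lemma twice_differentiable_onD:
  assumes "twice_differentiable_on U f" "y \<in> U"
  shows "f differentiable (at y)"
    "(f has_derivative frechet_derivative f (at y)) (at y)"
    "(\<lambda>z. frechet_derivative f (at z) v) differentiable (at y)"
  using assms by (auto simp: twice_differentiable_on_def simp flip: frechet_derivative_works)

lemma differentiable_transform_open:
  assumes "f differentiable (at x)" "open U" "x \<in> U" "\<And>y. y \<in> U \<Longrightarrow> f y = g y"
  shows "g differentiable (at x)"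
  using assms has_derivative_transform_within_open[of f _ x UNIV U g]
  unfolding differentiable_def by blast

lemma twice_differentiable_onI:
  assumes "open U" and f: "\<And>y. y \<in> U \<Longrightarrow> (f has_derivative D y) (at y)"
    and D: "\<And>y v. y \<in> U \<Longrightarrow> (\<lambda>z. D z v) differentiable (at y)"
  shows "twice_differentiable_on U f"
  unfolding twice_differentiable_on_def
proof (intro ballI conjI allI)
  fix y v assume y: "y \<in> U"
  show "f differentiable (at y)" using f[OF y] by (rule differentiableI)
  show "(\<lambda>z. frechet_derivative f (at z) v) differentiable (at y)"
    by (rule differentiable_transform_open[OF D[OF y] \<open>open U\<close> y])
      (simp add: frechet_derivative_at[OF f, symmetric])
qed

lemma twice_differentiable_on_cong:
  assumes "open U" "twice_differentiable_on U f" "\<And>y. y \<in> U \<Longrightarrow> f y = g y"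
  shows "twice_differentiable_on U g"
proof (rule twice_differentiable_onI[OF \<open>open U\<close>])
  fix y assume y: "y \<in> U"
  show "(g has_derivative frechet_derivative f (at y)) (at y)"
    by (rule has_derivative_transform_within_open[OF
        twice_differentiable_onD(2)[OF assms(2) y] \<open>open U\<close> y assms(3)])
  show "(\<lambda>z. frechet_derivative f (at z) v) differentiable (at y)" for v
    by (rule twice_differentiable_onD(3)[OF assms(2) y])
qed

lemma twice_differentiable_on_cross3:
  assumes "open U" "twice_differentiable_on U f" "twice_differentiable_on U g"
  shows "twice_differentiable_on U (\<lambda>y. f y \<times> g y)"
proof (rule twice_differentiable_onI[OF \<open>open U\<close>])
  fix y assume y: "y \<in> U"
  note f = twice_differentiable_onD[OF assms(2) y] and g = twice_differentiable_onD[OF assms(3) y]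
  show "((\<lambda>y. f y \<times> g y) has_derivative
      (\<lambda>v. f y \<times> frechet_derivative g (at y) v + frechet_derivative f (at y) v \<times> g y)) (at y)"
    by (rule bounded_bilinear.FDERIV[OF bounded_bilinear_cross3 f(2) g(2)])
  show "(\<lambda>y. f y \<times> frechet_derivative g (at y) v + frechet_derivative f (at y) v \<times> g y)
      differentiable (at y)" for v
    by (intro differentiable_add differentiable_cross3 f g)
qed

lemma differentiable_norm:
  fixes f :: "'a::real_normed_vector \<Rightarrow> 'b::real_inner"
  assumes "f differentiable (at x)" "f x \<noteq> 0"
  shows "(\<lambda>y. norm (f y)) differentiable (at x)"
  using differentiable_chain_at[OF assms(1) differentiable_norm_at[OF assms(2)]]
  by (simp add: o_def)

text \<open>The explicit formula shows that the derivative of \<open>sgn \<circ> f\<close> is again built from \<open>f\<close>, its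
  derivative and \<open>1 / norm f\<close>, hence differentiable when \<open>f\<close> is twice differentiable.\<close>

lemma has_derivative_sgn:
  fixes f :: "'a::real_normed_vector \<Rightarrow> 'b::real_inner"
  assumes f: "(f has_derivative f') (at x)" and "f x \<noteq> 0"
  shows "((\<lambda>y. sgn (f y)) has_derivative
    (\<lambda>v. inverse (norm (f x)) *\<^sub>R f' v - ((f x \<bullet> f' v) * inverse (norm (f x)) ^ 3) *\<^sub>R f x)) (at x)"
proof -
  have "((\<lambda>y. norm (f y)) has_derivative (\<lambda>v. sgn (f x) \<bullet> f' v)) (at x)"
    using has_derivative_compose[OF f has_derivative_norm[OF \<open>f x \<noteq> 0\<close>]]
    by (simp add: inner_commute)
  then have "((\<lambda>y. inverse (norm (f y))) has_derivative
      (\<lambda>v. - (inverse (norm (f x)) * (sgn (f x) \<bullet> f' v) * inverse (norm (f x))))) (at x)"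
    using \<open>f x \<noteq> 0\<close> by (intro Deriv.has_derivative_inverse) auto
  from has_derivative_scaleR[OF this f] show ?thesis
    unfolding sgn_div_norm[abs_def]
    by (rule has_derivative_eq_rhs) (auto simp: fun_eq_iff power3_eq_cube algebra_simps)
qed

lemma twice_differentiable_on_sgn:
  fixes f :: "'a::real_normed_vector \<Rightarrow> 'b::real_inner"
  assumes "open U" "twice_differentiable_on U f" "\<And>y. y \<in> U \<Longrightarrow> f y \<noteq> 0"
  shows "twice_differentiable_on U (\<lambda>y. sgn (f y))"
proof (rule twice_differentiable_onI[OF \<open>open U\<close>])
  fix y assume y: "y \<in> U"
  note f = twice_differentiable_onD[OF assms(2) y]
  show "((\<lambda>y. sgn (f y)) has_derivative (\<lambda>v. inverse (norm (f y)) *\<^sub>R frechet_derivative f (at y) v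
      - ((f y \<bullet> frechet_derivative f (at y) v) * inverse (norm (f y)) ^ 3) *\<^sub>R f y)) (at y)"
    by (rule has_derivative_sgn[OF f(2) assms(3)[OF y]])
  have "(\<lambda>z. inverse (norm (f z))) differentiable (at y)"
    using assms(3)[OF y] by (intro differentiable_inverse differentiable_norm f) auto
  then show "(\<lambda>z. inverse (norm (f z)) *\<^sub>R frechet_derivative f (at z) v
      - ((f z \<bullet> frechet_derivative f (at z) v) * inverse (norm (f z)) ^ 3) *\<^sub>R f z)
      differentiable (at y)" for v
    by (intro differentiable_diff differentiable_scaleR differentiable_mult differentiable_power
        differentiable_inner f)
qed

text \<open>Applied to pairs of members of a moving orthonormal frame, this gives the skew-symmetry of the
  matrix of the derivatives of the frame.\<close>

lemma inner_has_derivative_const: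
  fixes f :: "'a::real_normed_vector \<Rightarrow> 'b::real_inner"
  assumes "open U" "x \<in> U" "(f has_derivative f') (at x)" "(g has_derivative g') (at x)"
    and "\<And>y. y \<in> U \<Longrightarrow> f y \<bullet> g y = c"
  shows "f' v \<bullet> g x = - (f x \<bullet> g' v)"
proof -
  have "((\<lambda>_. c) has_derivative (\<lambda>v. f x \<bullet> g' v + f' v \<bullet> g x)) (at x)"
    by (rule has_derivative_transform_within_open[OF has_derivative_inner[OF assms(3,4)] assms(1,2)])
      (rule assms(5))
  from has_derivative_unique[OF this has_derivative_const]
  have "f x \<bullet> g' v + f' v \<bullet> g x = 0" by (rule fun_cong)
  then show ?thesis by simp
qed

section \<open>The moving frame and its connection form\<close>

locale oriented_chart =
  fixes S :: "(real^3) set" and N :: "real^3 \<Rightarrow> real^3"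
    and U :: "(real^2) set" and r :: "real^2 \<Rightarrow> real^3"
  assumes chart: "local_coordinates S U r"
    and orientation: "surface_orientation S N"
    and right_handed: "right_handed_coordinates N U r"
begin

definition normal :: "real^2 \<Rightarrow> real^3" where
  "normal y = N (r y)"

definition frame1 :: "real^2 \<Rightarrow> real^3" where
  "frame1 y = sgn (coord_vector r 1 y)"

definition frame2 :: "real^2 \<Rightarrow> real^3" where
  "frame2 y = normal y \<times> frame1 y"

text \<open>The connection form is the \<open>1\<close>-form \<open>v \<mapsto> \<langle>de\<^sub>1(v), e\<^sub>2\<rangle>\<close>. The adjoint yields the vector that
  represents it with respect to the inner product of the coordinate plane, see
  \<open>connection_form_inner\<close>; it is this vector that serves as the vector potential.\<close>

definition connection_form :: "real^2 \<Rightarrow> real^2" where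
  "connection_form y = adjoint (frechet_derivative frame1 (at y)) (frame2 y)"

abbreviation "D \<equiv> \<lambda>f y. frechet_derivative f (at y)"

lemma open_U: "open U"
  using chart by (simp add: local_coordinates_def)

lemma twice_differentiable_coord_vector: "twice_differentiable_on U (coord_vector r i)"
proof -
  have "times_differentiable_on (Suc (Suc (Suc 0))) U r"
    using chart unfolding local_coordinates_def smooth_on_def by blast
  then show ?thesis by (auto simp: coord_vector_def[abs_def] twice_differentiable_on_def)
qed

lemma twice_differentiable_normal: "twice_differentiable_on U normal"
proof (rule twice_differentiable_on_cong[OF open_U])
  show "twice_differentiable_on U (\<lambda>y. sgn (coord_vector r 1 y \<times> coord_vector r 2 y))"
    by (intro twice_differentiable_on_sgn twice_differentiable_on_cross3 open_U
        twice_differentiable_coord_vector unit_normal_eq(1)[OF chart orientation right_handed])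
qed (simp add: normal_def unit_normal_eq(2)[OF chart orientation right_handed])

lemma coord_vector_nonzero: "y \<in> U \<Longrightarrow> coord_vector r 1 y \<noteq> 0"
  using unit_normal_eq(1)[OF chart orientation right_handed] cross_zero_left by metis

lemma twice_differentiable_frame1: "twice_differentiable_on U frame1"
  unfolding frame1_def[abs_def]
  by (intro twice_differentiable_on_sgn open_U twice_differentiable_coord_vector
      coord_vector_nonzero)

lemma twice_differentiable_frame2: "twice_differentiable_on U frame2"
  unfolding frame2_def[abs_def]
  by (intro twice_differentiable_on_cross3 open_U twice_differentiable_normal
      twice_differentiable_frame1)

lemmas frame1_D = twice_differentiable_onD[OF twice_differentiable_frame1]
lemmas frame2_D = twice_differentiable_onD[OF twice_differentiable_frame2]
lemmas normal_D = twice_differentiable_onD[OF twice_differentiable_normal]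

lemma frame_orthonormal:
  assumes "y \<in> U"
  shows "normal y \<bullet> normal y = 1" "frame1 y \<bullet> frame1 y = 1" "frame2 y \<bullet> frame2 y = 1"
    "normal y \<bullet> frame1 y = 0" "normal y \<bullet> frame2 y = 0" "frame1 y \<bullet> frame2 y = 0"
proof -
  note n = unit_normal_chart[OF chart orientation assms]
  show 1: "normal y \<bullet> normal y = 1" "frame1 y \<bullet> frame1 y = 1" "normal y \<bullet> frame1 y = 0"
    using n coord_vector_nonzero[OF assms]
    by (auto simp: normal_def frame1_def norm_sgn simp flip: norm_eq_1)
      (simp add: sgn_div_norm)
  show "frame2 y \<bullet> frame2 y = 1" "normal y \<bullet> frame2 y = 0" "frame1 y \<bullet> frame2 y = 0"
    using cross_orthonormal(3)[OF 1(1,3)] 1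
    by (auto simp: frame2_def dot_cross_self power2_norm_eq_inner)
qed

lemma frame1_cross_frame2: "y \<in> U \<Longrightarrow> frame1 y \<times> frame2 y = normal y"
  using frame_orthonormal[of y] by (simp add: frame2_def Lagrange inner_commute)

lemma connection_form_inner:
  assumes "y \<in> U"
  shows "connection_form y \<bullet> v = D frame1 y v \<bullet> frame2 y"
proof -
  have "linear (D frame1 y)" using frame1_D(2)[OF assms] by (rule has_derivative_linear)
  from adjoint_works[OF this, of v "frame2 y"] show ?thesis
    by (simp add: connection_form_def inner_commute)
qed

lemma connection_form_differentiable:
  assumes "y \<in> U"
  shows "connection_form differentiable (at y)"
proof -
  have "(\<lambda>z. connection_form z \<bullet> b) differentiable (at y)" for b
    by (rule differentiable_transform_open[OF _ open_U assms])
      (auto simp: connection_form_inner intro!: differentiable_inner frame1_D frame2_D assms)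
  then show ?thesis by (subst differentiable_componentwise_within) simp
qed

text \<open>Along the frame \<open>(u, b, n)\<close> with \<open>b = n \<times> u\<close> the axial velocity is \<open>\<langle>w, u \<times> b\<rangle> = \<langle>w \<times> u, b\<rangle> = \<langle>du, b\<rangle>\<close>.
  Here \<open>u\<close> is \<open>e\<^sub>1\<close> turned by \<open>\<alpha>\<close>: the turning contributes \<open>\<beta>\<close>, and the rate at which the frame
  rotates in the tangent plane is the same for every vector fixed in it, so it contributes \<open>\<langle>de\<^sub>1, e\<^sub>2\<rangle>\<close>.\<close>

lemma axial_velocity_eq:
  assumes "y \<in> U"
  shows "axial_velocity N r (y, \<alpha>) (v, \<beta>) = \<beta> + connection_form y \<bullet> v"
proof -
  define w where "w = angular_velocity N r (y, \<alpha>) (v, \<beta>)"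
  define u where "u = material_radius N r"
  have u: "u = (\<lambda>q. cos (snd q) *\<^sub>R frame1 (fst q) + sin (snd q) *\<^sub>R frame2 (fst q))"
    by (simp add: u_def material_radius_def frame1_def frame2_def normal_def Let_def fun_eq_iff)
  define b where "b = cos \<alpha> *\<^sub>R frame2 y - sin \<alpha> *\<^sub>R frame1 y"
  note o = frame_orthonormal[OF assms]
  have ub: "u (y, \<alpha>) \<times> b = normal y"
  proof -
    have "u (y, \<alpha>) \<times> b
        = (cos \<alpha> * cos \<alpha>) *\<^sub>R (frame1 y \<times> frame2 y) + (sin \<alpha> * sin \<alpha>) *\<^sub>R (frame1 y \<times> frame2 y)"
      unfolding u b_def
      by (simp add: cross_add_left cross_mult_left cross_mult_right Cross3.right_diff_distrib
          cross_skew[of "frame2 y" "frame1 y"])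
    also have "\<dots> = ((cos \<alpha>)\<^sup>2 + (sin \<alpha>)\<^sup>2) *\<^sub>R (frame1 y \<times> frame2 y)"
      by (simp only: scaleR_add_left power2_eq_square)
    finally show ?thesis by (simp add: frame1_cross_frame2[OF assms])
  qed
  have D2: "D frame2 y v \<bullet> frame1 y = - (D frame1 y v \<bullet> frame2 y)"
    using inner_has_derivative_const[OF open_U assms frame2_D(2)[OF assms] frame1_D(2)[OF assms]]
      frame_orthonormal(6) by (metis inner_commute)
  have D11: "D frame1 y v \<bullet> frame1 y = 0"
    using inner_has_derivative_const[OF open_U assms frame1_D(2)[OF assms] frame1_D(2)[OF assms]
        frame_orthonormal(2), of v] by (simp add: inner_commute)
  have D22: "D frame2 y v \<bullet> frame2 y = 0"
    using inner_has_derivative_const[OF open_U assms frame2_D(2)[OF assms] frame2_D(2)[OF assms]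
        frame_orthonormal(3), of v] by (simp add: inner_commute)
  have fst: "(fst has_derivative fst) (at (y, \<alpha>))"
    by (intro bounded_linear_imp_has_derivative bounded_linear_fst)
  have "((\<lambda>q. frame1 (fst q)) has_derivative (\<lambda>h. D frame1 y (fst h))) (at (y, \<alpha>))"
    "((\<lambda>q. frame2 (fst q)) has_derivative (\<lambda>h. D frame2 y (fst h))) (at (y, \<alpha>))"
    using has_derivative_compose[OF fst, of frame1 "D frame1 y"] frame1_D(2)[OF assms]
      has_derivative_compose[OF fst, of frame2 "D frame2 y"] frame2_D(2)[OF assms] by simp_all
  then have "(u has_derivative (\<lambda>h. cos \<alpha> *\<^sub>R D frame1 y (fst h) + (- sin \<alpha> * snd h) *\<^sub>R frame1 y
      + (sin \<alpha> *\<^sub>R D frame2 y (fst h) + (cos \<alpha> * snd h) *\<^sub>R frame2 y))) (at (y, \<alpha>))"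
    unfolding u by (auto intro!: derivative_eq_intros simp: fun_eq_iff mult.commute)
  then have "D u (y, \<alpha>) (v, \<beta>) = cos \<alpha> *\<^sub>R D frame1 y v + (- sin \<alpha> * \<beta>) *\<^sub>R frame1 y
      + (sin \<alpha> *\<^sub>R D frame2 y v + (cos \<alpha> * \<beta>) *\<^sub>R frame2 y)"
    by (simp flip: frechet_derivative_at)
  moreover have "D u (y, \<alpha>) (v, \<beta>) = w \<times> u (y, \<alpha>)"
    using angular_velocity_works(1)[OF chart orientation right_handed, of "(y, \<alpha>)" "(v, \<beta>)"] assms
    by (simp add: u_def w_def)
  ultimately have wu: "w \<times> u (y, \<alpha>) = cos \<alpha> *\<^sub>R D frame1 y v + (- sin \<alpha> * \<beta>) *\<^sub>R frame1 y
      + (sin \<alpha> *\<^sub>R D frame2 y v + (cos \<alpha> * \<beta>) *\<^sub>R frame2 y)" by simp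
  have "axial_velocity N r (y, \<alpha>) (v, \<beta>) = w \<bullet> (u (y, \<alpha>) \<times> b)"
    by (simp add: axial_velocity_def w_def ub normal_def)
  also have "\<dots> = (w \<times> u (y, \<alpha>)) \<bullet> b"
    by (metis cross_triple inner_commute)
  also have "\<dots> = (cos \<alpha> * cos \<alpha>) * (\<beta> + D frame1 y v \<bullet> frame2 y)
      + (sin \<alpha> * sin \<alpha>) * (\<beta> + D frame1 y v \<bullet> frame2 y)"
    unfolding wu b_def using o D2 D11 D22
    by (simp add: inner_add_left inner_diff_right inner_commute[of "frame2 y" "frame1 y"] algebra_simps)
  also have "\<dots> = ((cos \<alpha>)\<^sup>2 + (sin \<alpha>)\<^sup>2) * (\<beta> + D frame1 y v \<bullet> frame2 y)"
    by (simp only: distrib_right power2_eq_square)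
  finally show ?thesis by (simp add: connection_form_inner[OF assms])
qed

section \<open>The curvature of the connection form\<close>

text \<open>Differentiating \<open>\<langle>de\<^sub>1(v), e\<^sub>2\<rangle>\<close> in the direction \<open>h\<close> gives a second derivative of \<open>e\<^sub>1\<close>, symmetric in
  \<open>h\<close> and \<open>v\<close>, and the term \<open>\<langle>de\<^sub>1(v), de\<^sub>2(h)\<rangle>\<close>. In that term the components along \<open>e\<^sub>1\<close> and \<open>e\<^sub>2\<close>
  contribute nothing, because a unit vector is orthogonal to its derivative; the components along
  \<open>n\<close> can be moved onto \<open>dn\<close> by orthogonality. Hence only derivatives of the Gauss map survive.\<close>

lemma curl_connection_form:
  assumes y: "y \<in> U"
  shows "D connection_form y h \<bullet> v - D connection_form y v \<bullet> h
    = - ((D normal y h \<times> D normal y v) \<bullet> normal y)"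
proof -
  note o = frame_orthonormal[OF y]
  have A: "D connection_form y h \<bullet> v
      = D (\<lambda>z. D frame1 z v) y h \<bullet> frame2 y + D frame1 y v \<bullet> D frame2 y h" for h v
  proof -
    have "((\<lambda>z. connection_form z \<bullet> v) has_derivative (\<lambda>h. D connection_form y h \<bullet> v)) (at y)"
      using connection_form_differentiable[OF y]
      by (intro has_derivative_inner_left) (simp add: frechet_derivative_works)
    then have "((\<lambda>z. D frame1 z v \<bullet> frame2 z) has_derivative (\<lambda>h. D connection_form y h \<bullet> v)) (at y)"
      by (rule has_derivative_transform_within_open[OF _ open_U y]) (rule connection_form_inner)
    moreover have "((\<lambda>z. D frame1 z v \<bullet> frame2 z) has_derivative
        (\<lambda>h. D frame1 y v \<bullet> D frame2 y h + D (\<lambda>z. D frame1 z v) y h \<bullet> frame2 y)) (at y)"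
      by (rule has_derivative_inner[OF
          frame1_D(3)[OF y, unfolded frechet_derivative_works] frame2_D(2)[OF y]])
    ultimately have "(\<lambda>h. D connection_form y h \<bullet> v)
        = (\<lambda>h. D frame1 y v \<bullet> D frame2 y h + D (\<lambda>z. D frame1 z v) y h \<bullet> frame2 y)"
      by (rule has_derivative_unique)
    from fun_cong[OF this, of h] show ?thesis by simp
  qed
  have sym: "D (\<lambda>z. D frame1 z v) y h = D (\<lambda>z. D frame1 z h) y v"
    by (rule second_derivative_symmetric[OF open_U y frame1_D(2)])
      (auto simp: frame1_D(3)[OF y] simp flip: frechet_derivative_works)
  \<comment> \<open>Only the normal components of the derivatives of the frame meet.\<close>
  have "D frame1 y h \<bullet> D frame2 y v = (D normal y h \<bullet> frame1 y) * (D normal y v \<bullet> frame2 y)" for h v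
  proof -
    have "D frame1 y h \<bullet> frame1 y = 0"
      using inner_has_derivative_const[OF open_U y frame1_D(2)[OF y] frame1_D(2)[OF y]
          frame_orthonormal(2), of h] by (simp add: inner_commute)
    moreover have "D frame2 y v \<bullet> frame2 y = 0"
      using inner_has_derivative_const[OF open_U y frame2_D(2)[OF y] frame2_D(2)[OF y]
          frame_orthonormal(3), of v] by (simp add: inner_commute)
    moreover have "D normal y h \<bullet> frame1 y = - (D frame1 y h \<bullet> normal y)"
      using inner_has_derivative_const[OF open_U y normal_D(2)[OF y] frame1_D(2)[OF y]
          frame_orthonormal(4), of h] by (simp add: inner_commute)
    moreover have "D normal y v \<bullet> frame2 y = - (D frame2 y v \<bullet> normal y)"
      using inner_has_derivative_const[OF open_U y normal_D(2)[OF y] frame2_D(2)[OF y]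
          frame_orthonormal(5), of v] by (simp add: inner_commute)
    moreover have "D frame1 y h \<bullet> D frame2 y v
        = (D frame1 y h \<bullet> frame1 y) * (frame1 y \<bullet> D frame2 y v)
        + (D frame1 y h \<bullet> frame2 y) * (frame2 y \<bullet> D frame2 y v)
        + (D frame1 y h \<bullet> normal y) * (normal y \<bullet> D frame2 y v)"
      by (subst orthonormal_expansion[OF o(1,2,4), of "D frame1 y h"])
        (simp add: inner_add_left frame2_def)
    ultimately show ?thesis by (simp add: inner_commute)
  qed
  moreover have "(D normal y h \<times> D normal y v) \<bullet> normal y
      = (D normal y h \<bullet> frame1 y) * (D normal y v \<bullet> frame2 y)
      - (D normal y h \<bullet> frame2 y) * (D normal y v \<bullet> frame1 y)"
    by (simp add: dot_cross_cross frame1_cross_frame2[OF y, symmetric])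
  ultimately show ?thesis unfolding A[of h v] A[of v h] sym by simp
qed

text \<open>Weingarten's equation, from differentiating \<open>\<langle>n, \<partial>\<^sub>j r\<rangle> = 0\<close>.\<close>

lemma weingarten:
  assumes "y \<in> U"
  shows "D normal y v \<bullet> coord_vector r j y
    = - (v $ 1 * second_form N r y $ 1 $ j + v $ 2 * second_form N r y $ 2 $ j)"
proof -
  have lin: "linear (D (coord_vector r j) y)"
    using twice_differentiable_onD(2)[OF twice_differentiable_coord_vector assms]
    by (rule has_derivative_linear)
  have v: "v = v $ 1 *\<^sub>R axis 1 1 + v $ 2 *\<^sub>R axis 2 1"
    by (simp add: vec_eq_iff forall_2 axis_def)
  have "D normal y v \<bullet> coord_vector r j y = - (normal y \<bullet> D (coord_vector r j) y v)"
    by (rule inner_has_derivative_const[OF open_U assms normal_D(2)[OF assms]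
        twice_differentiable_onD(2)[OF twice_differentiable_coord_vector assms], where c = 0])
      (simp add: normal_def unit_normal_chart(2)[OF chart orientation])
  also have "D (coord_vector r j) y v
      = v $ 1 *\<^sub>R D (coord_vector r j) y (axis 1 1) + v $ 2 *\<^sub>R D (coord_vector r j) y (axis 2 1)"
    by (subst v) (simp only: linear_add[OF lin] linear_cmul[OF lin])
  finally show ?thesis
    by (simp add: second_form_def normal_def[of y, symmetric] inner_add_right
        inner_commute[of "normal y"])
qed

lemma det_first_form:
  "det (first_form r y) = (norm (coord_vector r 1 y \<times> coord_vector r 2 y))\<^sup>2"
  by (simp add: det_2 first_form_def power2_norm_eq_inner dot_cross_cross)

text \<open>The Gauss map multiplies oriented area by \<open>K\<close>. The vector \<open>c = \<partial>\<^sub>1 r \<times> \<partial>\<^sub>2 r\<close> is \<open>norm c\<close> times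
  the normal; pairing with \<open>c\<close> turns the left side, by Weingarten's equation, into the
  determinant of the second form, while \<open>(norm c)\<^sup>2\<close> is the determinant of the first.\<close>

lemma gauss_map_area:
  assumes "y \<in> U"
  shows "(D normal y h \<times> D normal y v) \<bullet> normal y
    = gauss_curvature N r y * sqrt (det (first_form r y)) * (h $ 1 * v $ 2 - h $ 2 * v $ 1)"
proof -
  define c where "c = coord_vector r 1 y \<times> coord_vector r 2 y"
  have c: "c \<noteq> 0" "normal y = sgn c"
    using unit_normal_eq[OF chart orientation right_handed assms] by (auto simp: c_def normal_def)
  have "(D normal y h \<times> D normal y v) \<bullet> c
      = det (second_form N r y) * (h $ 1 * v $ 2 - h $ 2 * v $ 1)"
    unfolding c_def dot_cross_cross weingarten[OF assms] det_2 by (simp add: algebra_simps)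
  then have "(D normal y h \<times> D normal y v) \<bullet> normal y
      = det (second_form N r y) * (h $ 1 * v $ 2 - h $ 2 * v $ 1) / norm c"
    by (simp add: c(2) sgn_div_norm field_simps)
  also have "\<dots> = gauss_curvature N r y * norm c * (h $ 1 * v $ 2 - h $ 2 * v $ 1)"
    using c(1) by (simp add: gauss_curvature_def det_first_form c_def[symmetric] power2_eq_square)
  finally show ?thesis by (simp add: det_first_form c_def)
qed

text \<open>In two dimensions \<open>(DA)\<^sup>* - DA\<close> is skew, hence a multiple of the quarter turn; the factor is the
  Gaussian curvature times the area density.\<close>

lemma connection_form_curvature:
  assumes "y \<in> U"
  shows "adjoint (D connection_form y) v - D connection_form y v
    = (sqrt (det (first_form r y)) * gauss_curvature N r y) *\<^sub>R
        ((vector [vector [0, -1], vector [1, 0]] :: real^2^2) *v v)"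
proof -
  have lin: "linear (D connection_form y)"
    using connection_form_differentiable[OF assms]
    by (simp add: frechet_derivative_works has_derivative_linear)
  have "(adjoint (D connection_form y) v - D connection_form y v) \<bullet> h
    = ((sqrt (det (first_form r y)) * gauss_curvature N r y) *\<^sub>R
        ((vector [vector [0, -1], vector [1, 0]] :: real^2^2) *v v)) \<bullet> h" for h
  proof -
    have "(adjoint (D connection_form y) v - D connection_form y v) \<bullet> h
        = D connection_form y h \<bullet> v - D connection_form y v \<bullet> h"
      by (simp add: inner_diff_left inner_commute[of "adjoint _ v" h] adjoint_works[OF lin])
    also have "\<dots> = - (gauss_curvature N r y * sqrt (det (first_form r y))
        * (h $ 1 * v $ 2 - h $ 2 * v $ 1))"
      by (simp add: curl_connection_form[OF assms] gauss_map_area[OF assms])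
    finally show ?thesis
      by (simp add: inner_vec_def sum_2 matrix_vector_mult_def algebra_simps)
  qed
  then show ?thesis by (rule vector_eq_rdot[THEN iffD1, rule_format])
qed

section \<open>The kinetic energy of the disk\<close>

lemma twice_differentiable_chart: "twice_differentiable_on U r"
proof -
  have "times_differentiable_on (Suc (Suc 0)) U r"
    using chart unfolding local_coordinates_def smooth_on_def by blast
  then show ?thesis by (auto simp: twice_differentiable_on_def)
qed

lemma reduced_energy_eq:
  assumes "y \<in> U"
  shows "reduced_energy m I\<^sub>d N r y v
    = 1/2 * m * (D r y v \<bullet> D r y v) + 1/2 * I\<^sub>d * (D normal y v \<bullet> D normal y v)"
  using diametral_velocity_sq[OF chart orientation right_handed assms]
  by (simp add: reduced_energy_def center_speed_def power2_norm_eq_inner normal_def[abs_def])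

lemma kinetic_energy_eq:
  assumes "y \<in> U"
  shows "kinetic_energy m I\<^sub>a I\<^sub>d N r (y, \<alpha>) (v, \<beta>)
    = reduced_energy m I\<^sub>d N r y v + 1/2 * I\<^sub>a * (\<beta> + connection_form y \<bullet> v)\<^sup>2"
  by (simp add: kinetic_energy_def reduced_energy_def axial_velocity_eq[OF assms]
      diametral_velocity_sq[OF chart orientation right_handed assms])

lemma reduced_energy_differentiable:
  assumes "y \<in> U"
  shows "(\<lambda>z. reduced_energy m I\<^sub>d N r z v) differentiable (at y)"
    "reduced_energy m I\<^sub>d N r y differentiable (at v)"
proof -
  note r = twice_differentiable_onD[OF twice_differentiable_chart assms]
  note n = normal_D[OF assms]
  show "(\<lambda>z. reduced_energy m I\<^sub>d N r z v) differentiable (at y)"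
  proof (rule differentiable_transform_open[OF _ open_U assms])
    show "(\<lambda>z. 1/2 * m * (D r z v \<bullet> D r z v) + 1/2 * I\<^sub>d * (D normal z v \<bullet> D normal z v))
        differentiable (at y)"
      by (intro differentiable_add differentiable_mult differentiable_const differentiable_inner r n)
  qed (simp add: reduced_energy_eq)
  have lin: "D r y differentiable (at v)" "D normal y differentiable (at v)"
    using r(2) n(2) has_derivative_bounded_linear bounded_linear_imp_differentiable by blast+
  have eq: "reduced_energy m I\<^sub>d N r y = (\<lambda>w. 1/2 * m * (D r y w \<bullet> D r y w)
      + 1/2 * I\<^sub>d * (D normal y w \<bullet> D normal y w))"
    by (rule ext) (rule reduced_energy_eq[OF assms])
  show "reduced_energy m I\<^sub>d N r y differentiable (at v)"
    unfolding eq
    by (intro differentiable_add differentiable_mult differentiable_const differentiable_inner lin)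
qed

text \<open>Polarizing the given form of the metric shows that its coordinate vectors are orthogonal.\<close>

lemma det_first_form_orthogonal:
  assumes "y \<in> U"
    and metric: "\<And>v. (norm (D r y v))\<^sup>2 = a * (v $ 1)\<^sup>2 + b * (v $ 2)\<^sup>2"
  shows "det (first_form r y) = a * b"
proof -
  have lin: "linear (D r y)"
    using twice_differentiable_onD(2)[OF twice_differentiable_chart assms(1)]
    by (rule has_derivative_linear)
  have "coord_vector r 1 y \<bullet> coord_vector r 1 y = a" "coord_vector r 2 y \<bullet> coord_vector r 2 y = b"
    using metric[of "axis 1 1"] metric[of "axis 2 1"]
    by (simp_all add: coord_vector_def power2_norm_eq_inner axis_def)
  moreover have "(norm (coord_vector r 1 y + coord_vector r 2 y))\<^sup>2 = a + b"
    using metric[of "axis 1 1 + axis 2 1"]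
    by (simp add: coord_vector_def linear_add[OF lin] axis_def)
  ultimately have "coord_vector r 1 y \<bullet> coord_vector r 2 y = 0"
    by (simp add: power2_norm_eq_inner inner_add_left inner_add_right inner_commute)
  with \<open>_ = a\<close> \<open>_ = b\<close> show ?thesis
    by (simp add: det_2 first_form_def inner_commute)
qed

end

unbundle no cross3_syntax

section \<open>The motion of the disk\<close>

theorem theorem1:
  fixes S :: "(real^3) set" and N :: "real^3 \<Rightarrow> real^3"
    and U :: "(real^2) set" and r :: "real^2 \<Rightarrow> real^3"
    and a11 a22 :: "real^2 \<Rightarrow> real"
    and m I\<^sub>a I\<^sub>d :: real
    and \<I> :: "real set" and x :: "real \<Rightarrow> real^2" and \<theta> :: "real \<Rightarrow> real"
  assumes "smooth_surface S" and "surface_orientation S N"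
    and "local_coordinates S U r" and "right_handed_coordinates N U r"
    and metric: "\<And>y v. y \<in> U \<Longrightarrow>
      (norm (frechet_derivative r (at y) v))\<^sup>2 = a11 y * (v $ 1)\<^sup>2 + a22 y * (v $ 2)\<^sup>2"
    and "m > 0" and "I\<^sub>a > 0" and "I\<^sub>d > 0"
    and "open \<I>" and "is_interval \<I>"
    and motion: "euler_lagrange_solution (kinetic_energy m I\<^sub>a I\<^sub>d N r) (U \<times> UNIV) \<I>
      (\<lambda>t. (x t, \<theta> t))"
  defines "T \<equiv> reduced_energy m I\<^sub>d N r"
    and "K \<equiv> gauss_curvature N r"
    and "\<omega>\<^sub>a \<equiv> \<lambda>t. axial_velocity N r (x t, \<theta> t) (velocity x t, velocity \<theta> t)"
    and "J \<equiv> vector [vector [0, -1], vector [1, 0]] :: real^2^2"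
  shows "\<exists>L. \<forall>t\<in>\<I>. I\<^sub>a * \<omega>\<^sub>a t = L \<and>
    (\<lambda>s. vel_gradient T (x s) (velocity x s)) differentiable (at t) \<and>
    vector_derivative (\<lambda>s. vel_gradient T (x s) (velocity x s)) (at t)
      - pos_gradient T (x t) (velocity x t)
    = (sqrt (a11 (x t) * a22 (x t)) * L) *\<^sub>R (K (x t) *\<^sub>R (J *v velocity x t))"
proof -
  interpret oriented_chart S N U r
    using assms by unfold_locales
  have A: "(connection_form has_derivative D connection_form y) (at y)" if "y \<in> U" for y
    using connection_form_differentiable[OF that] by (simp add: frechet_derivative_works)
  obtain L where
    momentum: "\<And>t. t \<in> \<I> \<Longrightarrow> I\<^sub>a * (velocity \<theta> t + connection_form (x t) \<bullet> velocity x t) = L" and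
    center: "\<And>t. t \<in> \<I> \<Longrightarrow> ((\<lambda>s. vel_gradient T (x s) (velocity x s)) has_vector_derivative
        pos_gradient T (x t) (velocity x t)
          + L *\<^sub>R (adjoint (D connection_form (x t)) (velocity x t)
              - D connection_form (x t) (velocity x t))) (at t)"
    by (rule magnetic_euler_lagrange[where T = T, OF open_U _ _ _ A \<open>open \<I>\<close> \<open>is_interval \<I>\<close> motion])
      (auto simp: T_def kinetic_energy_eq reduced_energy_differentiable)
  show ?thesis
  proof (intro exI[of _ L] ballI conjI)
    fix t assume t: "t \<in> \<I>"
    then have U: "x t \<in> U" using motion by (auto simp: euler_lagrange_solution_def)
    show "I\<^sub>a * \<omega>\<^sub>a t = L"
      using momentum[OF t] by (simp add: \<omega>\<^sub>a_def axial_velocity_eq[OF U])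
    show "(\<lambda>s. vel_gradient T (x s) (velocity x s)) differentiable (at t)"
      using center[OF t] by (rule differentiableI_vector)
    show "vector_derivative (\<lambda>s. vel_gradient T (x s) (velocity x s)) (at t)
        - pos_gradient T (x t) (velocity x t)
      = (sqrt (a11 (x t) * a22 (x t)) * L) *\<^sub>R (K (x t) *\<^sub>R (J *v velocity x t))"
      unfolding vector_derivative_at[OF center[OF t]] connection_form_curvature[OF U]
        det_first_form_orthogonal[OF U metric[OF U]] K_def J_def
      by (simp add: mult_ac)
  qed
qed

end
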